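(* Let $\mathcal{G}=(\mathcal{V},\mathcal{E},A)$ be a weighted digraph with $n$ nodes that contains a directed spanning tree, and let $L$ be its graph Laplacian. Let $\bar f:\mathbb{R}\to\mathbb{R}$ be an increasing (i.e. nondecreasing, not necessarily continuous) function with $\lim_{s\to+\infty}\bar f(s)>0$ and $\lim_{s\to-\infty}\bar f(s)<0$. Consider the differential inclusion $$\dot x(t)\in -L\,\Big(\mathcal{F}[\bar f](x_1(t))\times\cdots\times\mathcal{F}[\bar f](x_n(t))\Big),\qquad x(t)\in\mathbb{R}^n, \qquad (\ast)$$ and assume that for every initial condition a complete solution of $(\ast)$ exists. Then every complete Filippov solution $x:[0,\infty)\to\mathbb{R}^n$ of $(\ast)$, from any initial condition, converges asymptotically, as $t\to\infty$, to the set $$\mathcal{D}_2=\Big\{x\in\mathbb{R}^n \;\Big|\; \exists a\in\mathbb{R}\text{ such that } a\in\mathcal{F}[\bar f](x_i)\text{ for all } i=1,\dots,n\Big\}.$$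
   Context: Graph conventions: a weighted digraph $\mathcal{G}=(\mathcal{V},\mathcal{E},A)$ has node set $\mathcal{V}=\{v_1,\dots,v_n\}$, edge set $\mathcal{E}\subseteq\mathcal{V}\times\mathcal{V}$, and weighted adjacency matrix $A=[a_{ij}]\in\mathbb{R}^{n\times n}$ with $a_{ij}\ge 0$, $a_{ii}=0$, and $a_{ij}>0$ if and only if $(v_j,v_i)\in\mathcal{E}$ (an edge from $v_j$ to $v_i$). The Laplacian is $L=\Delta-A$, where $\Delta$ is diagonal with $\Delta_{ii}=\sum_{j=1}^n a_{ij}$. A directed spanning tree of $\mathcal{G}$ is a weakly connected subgraph with node set $\mathcal{V}$ and $n-1$ edges from $\mathcal{E}$ in which every node has exactly one incoming edge, except one node (the root), which has none; equivalently, $\mathcal{G}$ contains a directed spanning tree if and only if some node has a directed path to every other node. Filippov map: for a map $X:\mathbb{R}^m\to\mathbb{R}^m$, $\mathcal{F}[X](x)=\bigcap_{\delta>0}\bigcap_{\mu(S)=0}\overline{\mathrm{co}}\{X(B(x,\delta)\setminus S)\}$, where $\mu$ is Lebesgue measure, $B(x,\delta)$ is the open ball, and $\overline{\mathrm{co}}$ is the closed convex hull. For a nondecreasing $\varphi:\mathbb{R}\to\mathbb{R}$ this is $\mathcal{F}[\varphi](s)=[\varphi(s^-),\varphi(s^+)]$, with one-sided limits. The inclusion $(\ast)$ is the Filippov interpretation of the system $\dot x=-Lf(x)$, $f(x)=[\bar f(x_1),\dots,\bar f(x_n)]^{\top}$. A (Filippov) solution of $(\ast)$ on an interval is a (locally)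 absolutely continuous function $x$ satisfying $(\ast)$ for almost every $t$ in that interval; it is complete if defined on $[0,\infty)$. A solution converges asymptotically to a set $D$ if $\inf_{y\in D}\|x(t)-y\|\to 0$ as $t\to\infty$. The limits of $\bar f$ at $\pm\infty$ are taken in the extended reals. *)

theory Defs
  imports "HOL-Analysis.Analysis" "Graph_Theory.Digraph_Component"
begin

text \<open>
  The nodes are the elements of the finite index type \<open>'n\<close>, with \<open>n = CARD('n)\<close>; the arc
  \<open>(j, i)\<close> goes from \<open>j\<close> to \<open>i\<close> and carries the weight \<open>A $ i $ j\<close> (row index = head).
\<close>

definition weighted_digraph :: "'n::finite pair_pre_digraph \<Rightarrow> real ^ 'n ^ 'n \<Rightarrow> bool" where
  "weighted_digraph G A \<longleftrightarrow>
     pverts G = UNIV \<and>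
     (\<forall>i j. 0 \<le> A $ i $ j) \<and>
     (\<forall>i. A $ i $ i = 0) \<and>
     (\<forall>i j. 0 < A $ i $ j \<longleftrightarrow> (j, i) \<in> parcs G)"

text \<open>
  \<open>Digraph_Component.connected\<close> is weak connectivity; the qualifier distinguishes it from
  topological connectedness.
\<close>

definition directed_spanning_tree :: "'n::finite pair_pre_digraph \<Rightarrow> 'n pair_pre_digraph \<Rightarrow> bool" where
  "directed_spanning_tree T G \<longleftrightarrow>
     spanning (with_proj T) (with_proj G) \<and>
     Digraph_Component.connected (with_proj T) \<and>
     card (parcs T) = card (pverts G) - 1 \<and>
     (\<exists>r\<in>pverts T. in_degree (with_proj T) r = 0 \<and>
        (\<forall>v\<in>pverts T - {r}. in_degree (with_proj T) v = 1))"

definition laplacian :: "real ^ 'n ^ 'n \<Rightarrow> real ^ 'n ^ 'n::finite" where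
  "laplacian A = (\<chi> i j. if i = j then \<Sum>k\<in>UNIV. A $ i $ k else 0) - A"

definition filippov_map :: "('a::euclidean_space \<Rightarrow> 'a) \<Rightarrow> 'a \<Rightarrow> 'a set" where
  "filippov_map X x =
     (\<Inter>\<delta>\<in>{0<..}. \<Inter>S\<in>null_sets lebesgue. closure (convex hull (X ` (ball x \<delta> - S))))"

text \<open>
  The finite family of non-overlapping intervals \<open>[a, b]\<close> is
  given by the set \<open>D\<close> of the pairs of their endpoints.
\<close>

definition absolutely_continuous_on :: "real set \<Rightarrow> (real \<Rightarrow> 'a::real_normed_vector) \<Rightarrow> bool" where
  "absolutely_continuous_on I x \<longleftrightarrow>
     (\<forall>\<epsilon>>0. \<exists>\<delta>>0. \<forall>D. finite D \<longrightarrow>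
        (\<forall>(a, b)\<in>D. a \<le> b \<and> {a..b} \<subseteq> I) \<longrightarrow>
        pairwise (\<lambda>(a, b) (c, d). {a<..<b} \<inter> {c<..<d} = {}) D \<longrightarrow>
        (\<Sum>(a, b)\<in>D. b - a) < \<delta> \<longrightarrow>
        (\<Sum>(a, b)\<in>D. norm (x b - x a)) < \<epsilon>)"

definition locally_absolutely_continuous_on ::
    "real set \<Rightarrow> (real \<Rightarrow> 'a::real_normed_vector) \<Rightarrow> bool" where
  "locally_absolutely_continuous_on I x \<longleftrightarrow>
     (\<forall>a b. {a..b} \<subseteq> I \<longrightarrow> absolutely_continuous_on {a..b} x)"

text \<open>
  Solution on the interval \<open>I\<close> of the differential inclusion with right-hand side \<open>\<Phi>\<close>;
  the values of \<open>x\<close> outside \<open>I\<close> are irrelevant.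
\<close>

definition inclusion_solution ::
    "('a::euclidean_space \<Rightarrow> 'a set) \<Rightarrow> real set \<Rightarrow> (real \<Rightarrow> 'a) \<Rightarrow> bool" where
  "inclusion_solution \<Phi> I x \<longleftrightarrow>
     locally_absolutely_continuous_on I x \<and>
     (AE t in lebesgue. t \<in> I \<longrightarrow>
        (\<exists>v\<in>\<Phi> (x t). (x has_vector_derivative v) (at t within I)))"

abbreviation complete_solution ::
    "('a::euclidean_space \<Rightarrow> 'a set) \<Rightarrow> (real \<Rightarrow> 'a) \<Rightarrow> bool" where
  "complete_solution \<Phi> x \<equiv> inclusion_solution \<Phi> {0..} x"

text \<open>
  Nonemptiness of \<open>D\<close> is required because \<open>infdist x {} = 0\<close> in the library, whereas the infimum
  over the empty set is \<open>\<infinity>\<close>.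
\<close>

definition converges_asymptotically :: "(real \<Rightarrow> 'a::metric_space) \<Rightarrow> 'a set \<Rightarrow> bool" where
  "converges_asymptotically x D \<longleftrightarrow>
     D \<noteq> {} \<and> ((\<lambda>t. infdist (x t) D) \<longlongrightarrow> 0) at_top"

definition consensus_rhs ::
    "real ^ 'n ^ 'n \<Rightarrow> (real \<Rightarrow> real) \<Rightarrow> real ^ 'n::finite \<Rightarrow> (real ^ 'n) set" where
  "consensus_rhs L f x =
     (\<lambda>w. - (L *v w)) ` {w. \<forall>i. w $ i \<in> filippov_map f (x $ i)}"

definition consensus_set :: "(real \<Rightarrow> real) \<Rightarrow> (real ^ 'n::finite) set" where
  "consensus_set f = {x. \<exists>a. \<forall>i. a \<in> filippov_map f (x $ i)}"

end

theory Submission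
  imports Defs "HOL-Complex_Analysis.Great_Picard"
begin

text \<open>
  Write \<open>m(t)\<close> and \<open>M(t)\<close> for the smallest and the largest component of a solution \<open>x\<close>. For
  nondecreasing \<open>f\<close>, a state belongs to the consensus set exactly if all its components coincide or
  \<open>f\<close> is constant strictly between its extreme components, so only the extremes matter. Along a
  solution \<open>M\<close> is nonincreasing and \<open>m\<close> is nondecreasing (\<open>node_max_nonincreasing\<close>); hence both
  converge, and it suffices to show that \<open>f\<close> is constant strictly between the two limits
  (\<open>constant_between_limit_extremes\<close>): clipping \<open>x(t)\<close> to the interval between the limits then gives a
  point of the consensus set whose distance from \<open>x(t)\<close> tends to \<open>0\<close>.

  The selection \<open>w(t)\<close> with \<open>x' = - L w\<close> is the obstacle to passing to limits: it comes without
  measurability, and weak compactness would be needed. It can be eliminated. A root \<open>r\<close> of the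
  spanning tree reaches every node, so the kernel of \<open>L\<close> consists of the constant vectors, and some
  linear \<open>C\<close> satisfies \<open>C (L w) = w\<^sub>r - w\<close> in every component (\<open>laplacian_left_inverse\<close>).
  Then \<open>z = C x\<close> has \<open>z\<^sub>i' - z\<^sub>j' = w\<^sub>i - w\<^sub>j\<close>, and integrating over \<open>[s, t]\<close>
  turns the inclusion into statements about increments of \<open>x\<close> and \<open>z\<close> only (\<open>averaged_solution\<close>).
  These survive uniform limits, and \<open>z\<close> is bounded because \<open>x\<close> is.

  Shifting time along a solution, the Arzela-Ascoli theorem yields a limit \<open>y\<close> of the same kind, on
  an interval of any prescribed length, whose extremes are constant: \<open>M\<close> and \<open>m\<close> from now on. In a
  short time window ending at \<open>t\<close>, let node \<open>i\<close> have the largest increment of \<open>z\<close> among the nodes that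
  are at \<open>M\<close> at time \<open>t\<close>; by monotonicity it is then the largest of all. The coupling cannot push
  \<open>i\<close> upwards, and \<open>i\<close> was not above \<open>M\<close> before, so all in-neighbours of \<open>i\<close> have the same increment.
  If the root is below \<open>M\<close> at time \<open>t\<close>, following arcs backwards therefore meets a node below \<open>M\<close> whose
  increment is still the largest. Such a node exists only if \<open>f\<close> is constant just below \<open>M\<close>, and then
  no node above the start of that flat part can increase. Read backwards in time this says that a node
  at \<open>M\<close> at the end of the interval was there all along (\<open>node_stays_at_max\<close>). The reflection
  \<open>y \<mapsto> - y\<close> gives the same for \<open>m\<close>. So on a long window one node stays at \<open>M\<close> and another one at \<open>m\<close>
  (\<open>nodes_stay_at_extremes\<close>); if \<open>f\<close> took two values strictly between \<open>m\<close> and \<open>M\<close>, the difference of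
  their \<open>z\<close>-components would grow linearly in time, which contradicts boundedness.
\<close>

section \<open>Absolutely continuous functions\<close>

lemma absolutely_continuous_on_bounded_linear:
  assumes x: "absolutely_continuous_on I x" and h: "bounded_linear h"
  shows "absolutely_continuous_on I (\<lambda>t. h (x t))"
  unfolding absolutely_continuous_on_def
proof (intro allI impI)
  fix \<epsilon> :: real assume "\<epsilon> > 0"
  obtain K where K: "K > 0" "\<And>v. norm (h v) \<le> norm v * K"
    using bounded_linear.pos_bounded[OF h] by blast
  have "\<epsilon> / K > 0" using \<open>\<epsilon> > 0\<close> K by simp
  then obtain \<delta> where "\<delta> > 0" and \<delta>: "\<And>D. finite D \<Longrightarrow> (\<forall>(a, b)\<in>D. a \<le> b \<and> {a..b} \<subseteq> I) \<Longrightarrow>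
      pairwise (\<lambda>(a, b) (c, d). {a<..<b} \<inter> {c<..<d} = {}) D \<Longrightarrow> (\<Sum>(a, b)\<in>D. b - a) < \<delta> \<Longrightarrow>
      (\<Sum>(a, b)\<in>D. norm (x b - x a)) < \<epsilon> / K"
    using x unfolding absolutely_continuous_on_def by meson
  show "\<exists>\<delta>>0. \<forall>D. finite D \<longrightarrow> (\<forall>(a, b)\<in>D. a \<le> b \<and> {a..b} \<subseteq> I) \<longrightarrow>
      pairwise (\<lambda>(a, b) (c, d). {a<..<b} \<inter> {c<..<d} = {}) D \<longrightarrow> (\<Sum>(a, b)\<in>D. b - a) < \<delta> \<longrightarrow>
      (\<Sum>(a, b)\<in>D. norm (h (x b) - h (x a))) < \<epsilon>"
  proof (intro exI conjI allI impI)
    show "\<delta> > 0" by fact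
    fix D assume D: "finite D" "\<forall>(a, b)\<in>D. a \<le> b \<and> {a..b} \<subseteq> I"
      "pairwise (\<lambda>(a, b) (c, d). {a<..<b} \<inter> {c<..<d} = {}) D" "(\<Sum>(a, b)\<in>D. b - a) < \<delta>"
    have "(\<Sum>(a, b)\<in>D. norm (h (x b) - h (x a))) \<le> (\<Sum>(a, b)\<in>D. norm (x b - x a) * K)"
      using K(2) by (intro sum_mono) (auto simp: linear_diff[OF bounded_linear.linear[OF h], symmetric])
    also have "\<dots> = (\<Sum>(a, b)\<in>D. norm (x b - x a)) * K"
      by (simp add: sum_distrib_right case_prod_beta)
    also have "\<dots> < \<epsilon>" using \<delta>[OF D] K by (simp add: field_simps)
    finally show "(\<Sum>(a, b)\<in>D. norm (h (x b) - h (x a))) < \<epsilon>" .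
  qed
qed

text \<open>
  The total length of finitely many non-overlapping intervals inside \<open>U\<close> is the measure of the
  union of their interiors.
\<close>
lemma sum_length_disjoint_intervals_less:
  fixes D :: "(real \<times> real) set"
  assumes "finite D" and le: "\<forall>(u, v)\<in>D. u \<le> v \<and> {u..v} \<subseteq> U"
    and disj: "pairwise (\<lambda>(a, b) (c, d). {a<..<b} \<inter> {c<..<d} = {}) D"
    and U: "U \<in> sets lebesgue" "emeasure lebesgue U < ennreal \<delta>"
  shows "(\<Sum>(u, v)\<in>D. v - u) < \<delta>"
proof -
  define J where "J = (\<lambda>(u::real, v). {u<..<v})"
  have fin: "U \<in> fmeasurable lebesgue"
    using U by (intro fmeasurableI) (auto intro: less_trans)
  have "(\<Sum>(u, v)\<in>D. v - u) = (\<Sum>p\<in>D. measure lebesgue (J p))"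
    using le by (intro sum.cong) (auto simp: J_def)
  also have "\<dots> = measure lebesgue (\<Union>p\<in>D. J p)"
  proof (rule measure_finite_Union[symmetric])
    show "disjoint_family_on J D"
      using disj unfolding disjoint_family_on_def pairwise_def J_def by (simp add: case_prod_beta)
  qed (use le \<open>finite D\<close> in \<open>auto simp: J_def\<close>)
  also have "\<dots> \<le> measure lebesgue U"
    using le \<open>finite D\<close>
    by (intro measure_mono_fmeasurable fin) (fastforce simp: J_def intro!: sets.finite_UN)+
  also have "\<dots> < \<delta>"
    using U(2) by (metis emeasure_eq_measure2 ennreal_less_iff fin measure_nonneg)
  finally show ?thesis .
qed

text \<open>
  No Lebesgue integral of the derivative is needed: Cousin's lemma provides a tagged division that is
  fine for a gauge adapted to the derivative at good tags and to a small open cover \<open>U\<close> of the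
  exceptional set \<open>N\<close> at bad tags. The pieces with good tags contribute almost nothing positive, and
  those with bad tags have small total length, so absolute continuity controls them.
\<close>
lemma absolutely_continuous_on_nonincreasing:
  fixes g :: "real \<Rightarrow> real"
  assumes ac: "absolutely_continuous_on {a..b} g" and "a \<le> b"
    and N: "N \<in> null_sets lebesgue"
    and deriv: "\<And>t. t \<in> {a..b} - N \<Longrightarrow> \<exists>d\<le>0. (g has_vector_derivative d) (at t within {a..b})"
  shows "g b - g a \<le> 0"
proof (rule field_le_epsilon)
  fix e0 :: real assume "e0 > 0"
  define e where "e = e0 / (b - a + 1)"
  have e: "e > 0" "e * (b - a) + e = e0"
  proof -
    have "b - a + 1 > 0" using \<open>a \<le> b\<close> by simp
    then show "e > 0" using \<open>e0 > 0\<close> by (simp add: e_def)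
    have "e * (b - a + 1) = e0" using \<open>b - a + 1 > 0\<close> by (simp add: e_def)
    then show "e * (b - a) + e = e0" by (simp add: distrib_left)
  qed
  obtain \<delta> where "\<delta> > 0" and \<delta>: "\<And>D. finite D \<Longrightarrow> (\<forall>(u, v)\<in>D. u \<le> v \<and> {u..v} \<subseteq> {a..b}) \<Longrightarrow>
      pairwise (\<lambda>(a, b) (c, d). {a<..<b} \<inter> {c<..<d} = {}) D \<Longrightarrow> (\<Sum>(u, v)\<in>D. v - u) < \<delta> \<Longrightarrow>
      (\<Sum>(u, v)\<in>D. norm (g v - g u)) < e"
    using ac \<open>e > 0\<close> unfolding absolutely_continuous_on_def by meson
  obtain U where U: "open U" "N \<subseteq> U" "U - N \<in> lmeasurable" "emeasure lebesgue (U - N) < ennreal \<delta>"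
    using sets_lebesgue_outer_open[of N \<delta>] N \<open>\<delta> > 0\<close> by auto
  have Us: "U \<in> sets lebesgue" using U(1) by (simp add: borel_open sets_completionI_sets)
  have Um: "emeasure lebesgue U < ennreal \<delta>"
    using U(4) emeasure_Diff_null_set[OF N Us] by simp
  have "\<exists>\<rho>>0. \<forall>u v. u \<in> {a..t} \<longrightarrow> v \<in> {t..b} \<longrightarrow> {u..v} \<subseteq> ball t \<rho> \<longrightarrow> g v - g u \<le> e * (v - u)"
    if t: "t \<in> {a..b} - N" for t
  proof -
    obtain d where d: "d \<le> 0" "(g has_vector_derivative d) (at t within {a..b})"
      using deriv[OF t] by blast
    then obtain \<rho> where "\<rho> > 0" and \<rho>: "\<And>y. y \<in> {a..b} \<Longrightarrow> norm (y - t) < \<rho> \<Longrightarrow>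
        norm (g y - g t - (y - t) *\<^sub>R d) \<le> e * norm (y - t)"
      using \<open>e > 0\<close> unfolding has_vector_derivative_def has_derivative_within_alt by blast
    show ?thesis
    proof (intro exI conjI allI impI)
      show "\<rho> > 0" by fact
      fix u v assume u: "u \<in> {a..t}" and v: "v \<in> {t..b}" and sub: "{u..v} \<subseteq> ball t \<rho>"
      have "u \<in> {u..v}" "v \<in> {u..v}" using u v by auto
      then have "u \<in> ball t \<rho>" "v \<in> ball t \<rho>" using sub by blast+
      then have "norm (u - t) < \<rho>" "norm (v - t) < \<rho>" by (simp_all add: dist_real_def)
      then have "norm (g u - g t - (u - t) *\<^sub>R d) \<le> e * norm (u - t)"
        "norm (g v - g t - (v - t) *\<^sub>R d) \<le> e * norm (v - t)"
        using \<rho>[of u] \<rho>[of v] u v t by auto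
      then have "g v - g t - (v - t) * d \<le> e * (v - t)" "- (g u - g t - (u - t) * d) \<le> e * (t - u)"
        using u v by auto
      then have "g v - g u \<le> (d + e) * (v - u)" by (simp add: algebra_simps)
      also have "\<dots> \<le> e * (v - u)" using d u v by (intro mult_right_mono) auto
      finally show "g v - g u \<le> e * (v - u)" .
    qed
  qed
  then obtain \<rho> where \<rho>: "\<And>t. t \<in> {a..b} - N \<Longrightarrow> \<rho> t > 0"
    "\<And>t u v. t \<in> {a..b} - N \<Longrightarrow> u \<in> {a..t} \<Longrightarrow> v \<in> {t..b} \<Longrightarrow> {u..v} \<subseteq> ball t (\<rho> t) \<Longrightarrow>
        g v - g u \<le> e * (v - u)"
    by metis
  define \<gamma> where "\<gamma> t = (if t \<in> N then U else if t \<in> {a..b} then ball t (\<rho> t) else UNIV)" for t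
  have "gauge \<gamma>"
    using \<rho>(1) U(1,2) by (auto simp: gauge_def \<gamma>_def)
  then obtain p where p: "p tagged_division_of {a..b}" "\<gamma> fine p"
    by (rule fine_division_exists_real)
  have fp: "finite p" using p by blast
  have pK: "\<exists>u v. K = {u..v} \<and> a \<le> u \<and> u \<le> t \<and> t \<le> v \<and> v \<le> b \<and> K \<subseteq> \<gamma> t" if tK: "(t, K) \<in> p" for t K
  proof -
    obtain u v where K: "K = cbox u v" using tagged_division_ofD(4)[OF p(1) tK] by blast
    have "t \<in> K" "K \<subseteq> {a..b}" using tagged_division_ofD(2,3)[OF p(1) tK] by auto
    with K p(2) tK show ?thesis
      by (intro exI[of _ u] exI[of _ v]) (auto simp: fine_def)
  qed
  have Inf_le_Sup: "Inf (snd q) \<le> Sup (snd q)" if q: "q \<in> p" for q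
  proof -
    obtain t K where tK: "q = (t, K)" by (cases q)
    with pK[of t K] q obtain u v where "K = {u..v}" "u \<le> t" "t \<le> v" by blast
    moreover from this have "u \<le> v" by linarith
    ultimately show ?thesis using tK by simp
  qed
  define w where "w = (\<lambda>(t::real, K). g (Sup K) - g (Inf K))"
  define p1 where "p1 = {q\<in>p. fst q \<notin> N}"
  \<comment> \<open>Degenerate pieces are dropped: they contribute nothing, and several tags may share one.\<close>
  define p2 where "p2 = {q\<in>p. fst q \<in> N \<and> Inf (snd q) < Sup (snd q)}"
  define D where "D = (\<lambda>q. (Inf (snd q), Sup (snd q))) ` p2"
  have int: "{u<..<v} \<inter> {u'<..<v'} = {}"
    if "(t, {u..v}) \<in> p" "(t', {u'..v'}) \<in> p" "(t, {u..v}) \<noteq> (t', {u'..v'})" for t t' u v u' v'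
    using tagged_division_ofD(5)[OF p(1) that] by (simp add: interior_Int[symmetric])
  have inj: "inj_on (\<lambda>q. (Inf (snd q), Sup (snd q))) p2"
  proof (rule inj_onI)
    fix q q' assume q: "q \<in> p2" "q' \<in> p2"
      and eq: "(Inf (snd q), Sup (snd q)) = (Inf (snd q'), Sup (snd q'))"
    obtain t K t' K' where tK: "q = (t, K)" "q' = (t', K')" by fastforce
    obtain u v where K: "K = {u..v}" "u \<le> v" using pK[of t K] q(1) tK by (auto simp: p2_def)
    obtain u' v' where K': "K' = {u'..v'}" "u' \<le> v'" using pK[of t' K'] q(2) tK by (auto simp: p2_def)
    have "u < v" "u' = u" "v' = v" using q(1) eq tK K K' by (auto simp: p2_def)
    then have "{u<..<v} \<inter> {u'<..<v'} \<noteq> {}" by simp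
    moreover have "(t, {u..v}) \<in> p" "(t', {u'..v'}) \<in> p" using q tK K K' by (auto simp: p2_def)
    ultimately show "q = q'" using int[of t u v t' u' v'] tK K K' by blast
  qed
  have D: "(\<Sum>(u, v)\<in>D. norm (g v - g u)) < e"
  proof (rule \<delta>)
    show "finite D" using fp by (simp add: D_def p2_def)
    have DE: "\<exists>t. (t, {fst q..snd q}) \<in> p \<and> fst q \<le> snd q \<and> {fst q..snd q} \<subseteq> {a..b} \<and> {fst q..snd q} \<subseteq> U" if qD: "q \<in> D" for q
    proof -
      obtain t K where tK: "(t, K) \<in> p" "fst q = Inf K" "snd q = Sup K" "t \<in> N"
        using qD by (auto simp: D_def p2_def)
      from pK[OF tK(1)] obtain u v where uv: "K = {u..v}" "a \<le> u" "u \<le> t" "t \<le> v" "v \<le> b" "K \<subseteq> \<gamma> t"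
        by blast
      then have "fst q = u" "snd q = v" using tK by auto
      then show ?thesis using tK uv by (intro exI[of _ t]) (auto simp: \<gamma>_def)
    qed
    then show "\<forall>(u, v)\<in>D. u \<le> v \<and> {u..v} \<subseteq> {a..b}" by fastforce
    have "{fst q<..<snd q} \<inter> {fst q'<..<snd q'} = {}" if q: "q \<in> D" "q' \<in> D" "q \<noteq> q'" for q q'
    proof -
      obtain t t' where t: "(t, {fst q..snd q}) \<in> p" "(t', {fst q'..snd q'}) \<in> p"
        "fst q \<le> snd q" "fst q' \<le> snd q'"
        using DE[OF q(1)] DE[OF q(2)] by blast
      with q(3) have "(t, {fst q..snd q}) \<noteq> (t', {fst q'..snd q'})" by (auto simp: prod_eq_iff)
      then show ?thesis by (rule int[OF t(1,2)])
    qed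
    then show disj: "pairwise (\<lambda>(a, b) (c, d). {a<..<b} \<inter> {c<..<d} = {}) D"
      unfolding pairwise_def case_prod_beta by blast
    show "(\<Sum>(u, v)\<in>D. v - u) < \<delta>"
    proof (rule sum_length_disjoint_intervals_less[OF \<open>finite D\<close> _ disj Us Um])
      show "\<forall>(u, v)\<in>D. u \<le> v \<and> {u..v} \<subseteq> U"
        using DE by fastforce
    qed
  qed
  have "g b - g a = sum w p"
    using additive_tagged_division_1[OF \<open>a \<le> b\<close> p(1), of g] by (simp add: w_def)
  also have "\<dots> = sum w p1 + sum w (p - p1)"
    using fp sum.subset_diff[of p1 p w] by (simp add: p1_def add.commute)
  also have "sum w (p - p1) = sum w p2"
  proof (rule sum.mono_neutral_right)
    show "\<forall>q\<in>p - p1 - p2. w q = 0"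
    proof
      fix q assume "q \<in> p - p1 - p2"
      then have "Inf (snd q) = Sup (snd q)"
        using Inf_le_Sup[of q] by (auto simp: p1_def p2_def)
      then show "w q = 0" by (simp add: w_def case_prod_beta)
    qed
  qed (use fp in \<open>auto simp: p1_def p2_def\<close>)
  also have "sum w p2 \<le> (\<Sum>(u, v)\<in>D. norm (g v - g u))"
    unfolding D_def sum.reindex[OF inj] by (intro sum_mono) (auto simp: w_def)
  also have "sum w p1 \<le> (\<Sum>q\<in>p1. e * (Sup (snd q) - Inf (snd q)))"
  proof (rule sum_mono)
    fix q assume "q \<in> p1"
    then obtain t K where q: "q = (t, K)" "(t, K) \<in> p" "t \<notin> N" by (cases q) (auto simp: p1_def)
    with pK obtain u v where "K = {u..v}" "a \<le> u" "u \<le> t" "t \<le> v" "v \<le> b" "K \<subseteq> \<gamma> t" by metis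
    then show "w q \<le> e * (Sup (snd q) - Inf (snd q))"
      using \<rho>(2)[of t u v] q by (auto simp: w_def \<gamma>_def)
  qed
  finally have 1: "g b - g a \<le> (\<Sum>q\<in>p1. e * (Sup (snd q) - Inf (snd q))) + e"
    using D by simp
  have "(\<Sum>q\<in>p1. Sup (snd q) - Inf (snd q)) \<le> (\<Sum>q\<in>p. Sup (snd q) - Inf (snd q))"
    using fp Inf_le_Sup by (intro sum_mono2) (auto simp: p1_def)
  also have "\<dots> = b - a"
    using additive_tagged_division_1[OF \<open>a \<le> b\<close> p(1), of "\<lambda>t. t"] by (simp add: case_prod_beta)
  finally have "e * (\<Sum>q\<in>p1. Sup (snd q) - Inf (snd q)) \<le> e * (b - a)"
    using \<open>e > 0\<close> by simp
  moreover have "(\<Sum>q\<in>p1. e * (Sup (snd q) - Inf (snd q))) = e * (\<Sum>q\<in>p1. Sup (snd q) - Inf (snd q))"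
    by (rule sum_distrib_left[symmetric])
  ultimately show "g b - g a \<le> 0 + e0"
    using 1 e(2) by linarith
qed

text \<open>
  Reduction to a nonpositive derivative by subtracting the linear function with slope \<open>c\<close>.
\<close>
lemma absolutely_continuous_on_increment_le:
  fixes g :: "real \<Rightarrow> real"
  assumes ac: "absolutely_continuous_on {a..b} g" and "a \<le> b"
    and N: "N \<in> null_sets lebesgue"
    and deriv: "\<And>t. t \<in> {a..b} - N \<Longrightarrow> \<exists>d\<le>c. (g has_vector_derivative d) (at t within {a..b})"
  shows "g b - g a \<le> c * (b - a)"
proof -
  have "absolutely_continuous_on {a..b} (\<lambda>t. g t - c * t)"
    unfolding absolutely_continuous_on_def
  proof (intro allI impI)
    fix \<epsilon> :: real assume "\<epsilon> > 0"
    then have "\<epsilon> / 2 > 0" by simp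
    then obtain \<delta> where "\<delta> > 0" and \<delta>: "\<And>D. finite D \<Longrightarrow> (\<forall>(u, v)\<in>D. u \<le> v \<and> {u..v} \<subseteq> {a..b}) \<Longrightarrow>
      pairwise (\<lambda>(a, b) (c, d). {a<..<b} \<inter> {c<..<d} = {}) D \<Longrightarrow> (\<Sum>(u, v)\<in>D. v - u) < \<delta> \<Longrightarrow>
      (\<Sum>(u, v)\<in>D. norm (g v - g u)) < \<epsilon> / 2"
      using ac unfolding absolutely_continuous_on_def by meson
    \<comment> \<open>The second term absorbs the contribution of the slope to the variation.\<close>
    define \<eta> where "\<eta> = min \<delta> (\<epsilon> / (2 * (\<bar>c\<bar> + 1)))"
    have \<eta>: "\<eta> > 0" "\<eta> \<le> \<delta>" "\<bar>c\<bar> * \<eta> \<le> \<epsilon> / 2"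
    proof -
      show "\<eta> > 0" "\<eta> \<le> \<delta>" using \<open>\<delta> > 0\<close> \<open>\<epsilon> > 0\<close> by (auto simp: \<eta>_def)
      have "\<bar>c\<bar> * \<eta> \<le> (\<bar>c\<bar> + 1) * \<eta>" using \<open>\<eta> > 0\<close> by simp
      also have "\<dots> \<le> (\<bar>c\<bar> + 1) * (\<epsilon> / (2 * (\<bar>c\<bar> + 1)))" by (intro mult_left_mono) (auto simp: \<eta>_def)
      also have "\<dots> = \<epsilon> / 2" by (simp add: field_simps)
      finally show "\<bar>c\<bar> * \<eta> \<le> \<epsilon> / 2" .
    qed
    show "\<exists>\<delta>>0. \<forall>D. finite D \<longrightarrow> (\<forall>(u, v)\<in>D. u \<le> v \<and> {u..v} \<subseteq> {a..b}) \<longrightarrow>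
      pairwise (\<lambda>(a, b) (c, d). {a<..<b} \<inter> {c<..<d} = {}) D \<longrightarrow> (\<Sum>(u, v)\<in>D. v - u) < \<delta> \<longrightarrow>
      (\<Sum>(u, v)\<in>D. norm (g v - c * v - (g u - c * u))) < \<epsilon>"
    proof (intro exI conjI allI impI)
      show "\<eta> > 0" by fact
      fix D assume D: "finite D" "\<forall>(u, v)\<in>D. u \<le> v \<and> {u..v} \<subseteq> {a..b}"
        "pairwise (\<lambda>(a, b) (c, d). {a<..<b} \<inter> {c<..<d} = {}) D" "(\<Sum>(u, v)\<in>D. v - u) < \<eta>"
      have "norm (g v - c * v - (g u - c * u)) \<le> norm (g v - g u) + \<bar>c\<bar> * (v - u)" if "(u, v) \<in> D" for u v
      proof -
        have "u \<le> v" using D that by auto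
        then have "norm (c * (v - u)) = \<bar>c\<bar> * (v - u)" by (simp add: abs_mult)
        moreover have "g v - c * v - (g u - c * u) = (g v - g u) - c * (v - u)"
          by (simp add: algebra_simps)
        ultimately show ?thesis
          using norm_triangle_ineq4[of "g v - g u" "c * (v - u)"] by simp
      qed
      then have "(\<Sum>(u, v)\<in>D. norm (g v - c * v - (g u - c * u)))
        \<le> (\<Sum>(u, v)\<in>D. norm (g v - g u) + \<bar>c\<bar> * (v - u))"
        by (intro sum_mono) auto
      also have "\<dots> = (\<Sum>(u, v)\<in>D. norm (g v - g u)) + \<bar>c\<bar> * (\<Sum>(u, v)\<in>D. v - u)"
        by (simp add: sum.distrib case_prod_beta sum_distrib_left)
      also have "\<dots> < \<epsilon> / 2 + \<bar>c\<bar> * \<eta>"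
        using \<delta>[OF D(1-3)] D(4) \<eta>(2) by (intro add_less_le_mono mult_left_mono) auto
      also have "\<dots> \<le> \<epsilon>" using \<eta>(3) by simp
      finally show "(\<Sum>(u, v)\<in>D. norm (g v - c * v - (g u - c * u))) < \<epsilon>" .
    qed
  qed
  then have "g b - c * b - (g a - c * a) \<le> 0"
  proof (rule absolutely_continuous_on_nonincreasing[OF _ \<open>a \<le> b\<close> N])
    fix t assume "t \<in> {a..b} - N"
    then obtain d where d: "d \<le> c" "(g has_vector_derivative d) (at t within {a..b})"
      using deriv by blast
    have "((\<lambda>t. g t - c * t) has_vector_derivative (d - c)) (at t within {a..b})"
      using d(2) by (auto intro!: derivative_eq_intros simp: has_real_derivative_iff_has_vector_derivative[symmetric])
    with d(1) show "\<exists>d\<le>0. ((\<lambda>t. g t - c * t) has_vector_derivative d) (at t within {a..b})"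
      by (intro exI[of _ "d - c"]) auto
  qed
  then show ?thesis by (simp add: algebra_simps)
qed

lemma absolutely_continuous_on_imp_continuous_on:
  assumes "absolutely_continuous_on {a..b} x"
  shows "continuous_on {a..b} x"
  unfolding continuous_on_iff
proof (intro ballI allI impI)
  fix t \<epsilon> :: real assume t: "t \<in> {a..b}" and "\<epsilon> > 0"
  then obtain \<delta> where "\<delta> > 0" and \<delta>: "\<And>D. finite D \<Longrightarrow> (\<forall>(u, v)\<in>D. u \<le> v \<and> {u..v} \<subseteq> {a..b}) \<Longrightarrow>
      pairwise (\<lambda>(a, b) (c, d). {a<..<b} \<inter> {c<..<d} = {}) D \<Longrightarrow> (\<Sum>(u, v)\<in>D. v - u) < \<delta> \<Longrightarrow>
      (\<Sum>(u, v)\<in>D. norm (x v - x u)) < \<epsilon>"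
    using assms unfolding absolutely_continuous_on_def by meson
  have small: "norm (x v - x u) < \<epsilon>" if "u \<le> v" "u \<in> {a..b}" "v \<in> {a..b}" "v - u < \<delta>" for u v
    using \<delta>[of "{(u, v)}"] that by simp
  have "dist (x u) (x t) < \<epsilon>" if "u \<in> {a..b}" "dist u t < \<delta>" for u
  proof (cases "u \<le> t")
    case True
    then show ?thesis using small[of u t] that t by (simp add: dist_norm norm_minus_commute)
  next
    case False
    then show ?thesis using small[of t u] that t by (simp add: dist_norm)
  qed
  with \<open>\<delta> > 0\<close> show "\<exists>d>0. \<forall>u\<in>{a..b}. dist u t < d \<longrightarrow> dist (x u) (x t) < \<epsilon>" by blast
qed

section \<open>Values of the Filippov map\<close>

text \<open>
  Null sets cannot swallow an interval, so the essential values in the Filippov map can be sampled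
  from any prescribed interval.
\<close>
lemma interval_minus_null_set_nonempty:
  fixes a b :: real
  assumes "S \<in> null_sets lebesgue" "a < b"
  obtains x where "a < x" "x < b" "x \<notin> S"
proof -
  have "\<not> {a<..<b} \<subseteq> S"
  proof
    assume "{a<..<b} \<subseteq> S"
    then have "negligible {a<..<b}"
      using assms(1) negligible_subset by (auto simp: negligible_iff_null_sets)
    then show False using assms(2) open_not_negligible[of "{a<..<b}"] by auto
  qed
  then show thesis using that by (meson greaterThanLessThan_iff subsetI)
qed

text \<open>
  Stated with strict bounds \<open>\<alpha> < s < \<gamma>\<close> instead of one-sided limits of \<open>f\<close>: in this form the
  bounds persist when \<open>s\<close> varies slightly, as it does under uniform limits.
\<close>
lemma filippov_map_bounds:
  fixes f :: "real \<Rightarrow> real"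
  assumes "mono f" "w \<in> filippov_map f s" "\<alpha> < s" "s < \<gamma>"
  shows "f \<alpha> \<le> w" "w \<le> f \<gamma>"
proof -
  have "min (s - \<alpha>) (\<gamma> - s) \<in> {0<..}" using assms by auto
  moreover have "{} \<in> null_sets lebesgue" by simp
  ultimately have "w \<in> closure (convex hull (f ` (ball s (min (s - \<alpha>) (\<gamma> - s)) - {})))"
    using assms(2) unfolding filippov_map_def by blast
  moreover have "f ` (ball s (min (s - \<alpha>) (\<gamma> - s)) - {}) \<subseteq> {f \<alpha>..f \<gamma>}"
    using \<open>mono f\<close> by (auto simp: dist_real_def intro!: monoD[of f])
  then have "closure (convex hull (f ` (ball s (min (s - \<alpha>) (\<gamma> - s)) - {}))) \<subseteq> {f \<alpha>..f \<gamma>}"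
    by (intro closure_minimal hull_minimal) auto
  ultimately show "f \<alpha> \<le> w" "w \<le> f \<gamma>" by auto
qed

text \<open>
  Both sides of \<open>s\<close> are sampled, and \<open>f s\<close> lies between the two sampled values.
\<close>
lemma self_in_filippov_map:
  fixes f :: "real \<Rightarrow> real"
  assumes "mono f"
  shows "f s \<in> filippov_map f s"
  unfolding filippov_map_def
proof (intro INT_I)
  fix \<delta> :: real and S :: "real set" assume "\<delta> \<in> {0<..}" and S: "S \<in> null_sets lebesgue"
  then have "\<delta> > 0" by simp
  obtain u where u: "s - \<delta> < u" "u < s" "u \<notin> S"
    using interval_minus_null_set_nonempty[OF S, of "s - \<delta>" s] \<open>\<delta> > 0\<close> by auto
  obtain v where v: "s < v" "v < s + \<delta>" "v \<notin> S"
    using interval_minus_null_set_nonempty[OF S, of s "s + \<delta>"] \<open>\<delta> > 0\<close> by auto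
  have "{f u, f v} \<subseteq> f ` (ball s \<delta> - S)" using u v by (auto simp: dist_real_def)
  then have "convex hull {f u, f v} \<subseteq> convex hull (f ` (ball s \<delta> - S))" by (rule hull_mono)
  moreover have "f u \<le> f s" "f s \<le> f v" using u v \<open>mono f\<close> by (auto intro: monoD)
  then have "f s \<in> convex hull {f u, f v}"
    by (auto simp: segment_convex_hull[symmetric] closed_segment_eq_real_ivl)
  ultimately show "f s \<in> closure (convex hull (f ` (ball s \<delta> - S)))"
    using closure_subset by blast
qed

lemma constant_in_filippov_map:
  fixes f :: "real \<Rightarrow> real"
  assumes const: "\<And>u. m < u \<Longrightarrow> u < M \<Longrightarrow> f u = c" and "m < M" "m \<le> s" "s \<le> M"
  shows "c \<in> filippov_map f s"
  unfolding filippov_map_def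
proof (intro INT_I)
  fix \<delta> :: real and S :: "real set" assume "\<delta> \<in> {0<..}" and S: "S \<in> null_sets lebesgue"
  then have "max m (s - \<delta>) < min M (s + \<delta>)" using assms by auto
  then obtain u where u: "max m (s - \<delta>) < u" "u < min M (s + \<delta>)" "u \<notin> S"
    using interval_minus_null_set_nonempty[OF S] by metis
  then have "f u = c" "u \<in> ball s \<delta> - S" using const by (auto simp: dist_real_def)
  then have "c \<in> f ` (ball s \<delta> - S)" by blast
  then show "c \<in> closure (convex hull (f ` (ball s \<delta> - S)))"
    by (meson closure_subset hull_subset subsetD)
qed

section \<open>Rooted weights and the kernel of the Laplacian\<close>

text \<open>
  A set that contains, with each node, all tails of its incoming arcs must contain \<open>r\<close>. This says
  that \<open>r\<close> reaches every node, in the form in which maximum principles use it: it is applied to the set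
  of nodes at which some quantity is maximal.
\<close>
locale rooted_weights =
  fixes A :: "real ^ 'n ^ 'n::finite" and r :: 'n
  assumes nonneg: "0 \<le> A $ i $ j"
    and root: "K \<noteq> {} \<Longrightarrow> (\<And>i j. i \<in> K \<Longrightarrow> 0 < A $ i $ j \<Longrightarrow> j \<in> K) \<Longrightarrow> r \<in> K"

text \<open>
  In the tree \<open>T\<close> the set \<open>R\<close> of nodes reachable from the root is closed under arcs in both
  directions: backwards because the only arc into a node of \<open>R\<close> other than the root is the last arc of
  a path from the root. Weak connectivity then leaves no node outside \<open>R\<close>.
\<close>
lemma directed_spanning_tree_rooted_weights:
  fixes G :: "'n::finite pair_pre_digraph"
  assumes G: "weighted_digraph G A" and T: "directed_spanning_tree T G"
  shows "\<exists>r. rooted_weights A r"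
proof -
  have pv: "pverts T = UNIV" and sub: "parcs T \<subseteq> parcs G"
    and con: "Digraph_Component.connected (with_proj T)"
    using G T by (auto simp: weighted_digraph_def directed_spanning_tree_def spanning_def subgraph_def)
  obtain r where r: "in_degree (with_proj T) r = 0"
    "\<And>v. v \<noteq> r \<Longrightarrow> in_degree (with_proj T) v = 1"
    using T pv by (auto simp: directed_spanning_tree_def)
  have no_in: "(u, r) \<notin> parcs T" for u
  proof -
    have "in_arcs (with_proj T) r = {}" using r(1) by (simp add: in_degree_def)
    then show ?thesis by (auto simp: in_arcs_def)
  qed
  have uniq: "u = u'" if "(u, v) \<in> parcs T" "(u', v) \<in> parcs T" for u u' v
  proof -
    have "v \<noteq> r" using that no_in by auto
    then have "card (in_arcs (with_proj T) v) = 1" using r(2) by (simp add: in_degree_def)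
    then obtain e where "in_arcs (with_proj T) v = {e}" by (meson card_1_singletonE)
    moreover have "(u, v) \<in> in_arcs (with_proj T) v" "(u', v) \<in> in_arcs (with_proj T) v"
      using that by (auto simp: in_arcs_def)
    ultimately show ?thesis by auto
  qed
  define R where "R = {v. (r, v) \<in> (parcs T)\<^sup>*}"
  have arc: "u \<in> R \<longleftrightarrow> v \<in> R" if uv: "(u, v) \<in> parcs T" for u v
  proof
    show "u \<in> R \<Longrightarrow> v \<in> R" using uv by (auto simp: R_def)
    assume "v \<in> R"
    then have "(r, v) \<in> (parcs T)\<^sup>*" by (simp add: R_def)
    then show "u \<in> R"
    proof (cases rule: rtranclE)
      case base
      then show ?thesis using uv no_in by auto
    next
      case (step w)
      then show ?thesis using uniq[OF uv step(2)] by (simp add: R_def)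
    qed
  qed
  have reach: "v \<in> R" for v
  proof -
    have "(r, v) \<in> rtrancl_on (verts (with_proj (mk_symmetric (with_proj T)))) (arcs_ends (with_proj (mk_symmetric (with_proj T))))"
      using con pv by (auto simp: connected_def strongly_connected_def reachable_def)
    then show ?thesis
    proof (induction rule: rtrancl_on_induct)
      case base
      then show ?case by (simp add: R_def)
    next
      case (step y z)
      then have "(y, z) \<in> parcs T \<or> (z, y) \<in> parcs T" by (auto simp: parcs_mk_symmetric)
      then show ?case using arc step by blast
    qed
  qed
  have "r \<in> K" if "K \<noteq> {}" and closed: "\<And>i j. i \<in> K \<Longrightarrow> 0 < A $ i $ j \<Longrightarrow> j \<in> K" for K
  proof -
    obtain i where "i \<in> K" using \<open>K \<noteq> {}\<close> by blast
    have "(r, i) \<in> (parcs T)\<^sup>*" using reach by (simp add: R_def)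
    then show ?thesis
    proof (induction rule: converse_rtrancl_induct)
      case base
      show ?case by fact
    next
      case (step y z)
      then have "0 < A $ z $ y" using sub G by (auto simp: weighted_digraph_def)
      then show ?case using closed step by blast
    qed
  qed
  moreover have "0 \<le> A $ i $ j" for i j using G by (simp add: weighted_digraph_def)
  ultimately have "rooted_weights A r" by unfold_locales auto
  then show ?thesis ..
qed

lemma laplacian_mult_vec:
  "(laplacian A *v w) $ i = (\<Sum>j\<in>UNIV. A $ i $ j * (w $ i - w $ j))"
proof -
  have "(laplacian A *v w) $ i = (\<Sum>j\<in>UNIV. (if i = j then \<Sum>k\<in>UNIV. A $ i $ k else 0) * w $ j) - (\<Sum>j\<in>UNIV. A $ i $ j * w $ j)"
    by (simp add: laplacian_def matrix_vector_mult_def left_diff_distrib sum_subtractf)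
  also have "(\<Sum>j\<in>UNIV. (if i = j then \<Sum>k\<in>UNIV. A $ i $ k else 0) * w $ j) = (\<Sum>k\<in>UNIV. A $ i $ k) * w $ i"
    by (simp add: if_distrib[of "\<lambda>c. c * _"] cong: if_cong)
  finally show ?thesis by (simp add: sum_distrib_right right_diff_distrib sum_subtractf)
qed

context rooted_weights
begin

lemma coupling_nonpos_at_max:
  fixes w :: "real ^ 'n"
  assumes "\<And>j. w $ j \<le> w $ i"
  shows "(\<Sum>j\<in>UNIV. A $ i $ j * (w $ j - w $ i)) \<le> 0"
  using assms nonneg by (intro sum_nonpos mult_nonneg_nonpos) auto

text \<open>
  The maximum principle: where \<open>w\<close> is maximal, all terms of the coupling sum are nonpositive, so if
  the sum is nonnegative, all in-neighbours are maximal too, and the root is reached backwards. The set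
  \<open>K\<close> records a property known for all maximal nodes, to be transferred to the root.
\<close>
lemma root_attains_max:
  fixes w :: "real ^ 'n"
  assumes i: "i \<in> K" "\<And>j. w $ j \<le> w $ i"
    and K: "\<And>k. (\<And>j. w $ j \<le> w $ k) \<Longrightarrow> k \<in> K \<and> 0 \<le> (\<Sum>j\<in>UNIV. A $ k $ j * (w $ j - w $ k))"
  shows "r \<in> K" "w $ j \<le> w $ r"
proof -
  have "r \<in> {k. \<forall>j. w $ j \<le> w $ k}"
  proof (rule root)
    show "{k. \<forall>j. w $ j \<le> w $ k} \<noteq> {}" using i by blast
    fix k l assume k: "k \<in> {k. \<forall>j. w $ j \<le> w $ k}" and "0 < A $ k $ l"
    then have "0 \<le> (\<Sum>j\<in>UNIV. A $ k $ j * (w $ j - w $ k))" using K by blast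
    then have "(\<Sum>j\<in>UNIV. A $ k $ j * (w $ k - w $ j)) \<le> 0"
      by (simp add: right_diff_distrib sum_subtractf)
    moreover have "A $ k $ l * (w $ k - w $ l) \<le> (\<Sum>j\<in>UNIV. A $ k $ j * (w $ k - w $ j))"
      using k nonneg by (intro member_le_sum) auto
    ultimately have "w $ k \<le> w $ l" using \<open>0 < A $ k $ l\<close>
      by (smt (verit) mult_pos_pos)
    then show "l \<in> {k. \<forall>j. w $ j \<le> w $ k}" using k by (auto intro: order_trans)
  qed
  then show "r \<in> K" "w $ j \<le> w $ r" using K by auto
qed

lemma laplacian_kernel:
  assumes "laplacian A *v w = 0"
  shows "w $ i = w $ r"
proof -
  have 0: "(\<Sum>j\<in>UNIV. A $ k $ j * (w $ j - w $ k)) = 0" for k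
  proof -
    have "(\<Sum>j\<in>UNIV. A $ k $ j * (w $ j - w $ k)) = - ((laplacian A *v w) $ k)"
      unfolding laplacian_mult_vec by (simp add: right_diff_distrib sum_subtractf)
    with assms show ?thesis by simp
  qed
  have ex: "\<exists>k. \<forall>j. v $ j \<le> v $ k" for v :: "real ^ 'n"
  proof -
    have "Max (range (($) v)) \<in> range (($) v)" by (intro Max_in) auto
    then obtain k where k: "Max (range (($) v)) = v $ k" by (rule rangeE)
    have "v $ j \<le> Max (range (($) v))" for j by (intro Max_ge) auto
    then show ?thesis using k by auto
  qed
  obtain k where "\<And>j. w $ j \<le> w $ k" using ex by blast
  then have "w $ i \<le> w $ r" using root_attains_max(2)[of k UNIV w i] 0 by auto
  moreover obtain k where "\<And>j. (- w) $ j \<le> (- w) $ k" using ex by blast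
  then have "(- w) $ i \<le> (- w) $ r"
  proof (intro root_attains_max(2)[of k UNIV "- w" i], simp_all)
    show "0 \<le> (\<Sum>j\<in>UNIV. A $ k $ j * (w $ k - w $ j))" for k
      using 0[of k] by (simp add: right_diff_distrib sum_subtractf)
  qed
  ultimately show ?thesis by simp
qed

text \<open>
  Modulo constant vectors, the selection \<open>w\<close> can be recovered linearly from \<open>L w\<close>; the vectors with
  \<open>r\<close>-component \<open>0\<close> represent the classes.
\<close>
lemma laplacian_left_inverse:
  "\<exists>C. linear C \<and> (\<forall>w i. C (laplacian A *v w) $ i = w $ i - w $ r)"
proof -
  define S where "S = {w :: real ^ 'n. w $ r = 0}"
  have S: "subspace S" by (auto simp: S_def subspace_def)
  have inj: "inj_on ((*v) (laplacian A)) S"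
  proof (rule inj_onI)
    fix v w assume "v \<in> S" "w \<in> S" "laplacian A *v v = laplacian A *v w"
    then have "laplacian A *v (v - w) = 0" by (simp add: matrix_vector_mult_diff_distrib)
    then have "(v - w) $ i = (v - w) $ r" for i by (rule laplacian_kernel)
    with \<open>v \<in> S\<close> \<open>w \<in> S\<close> show "v = w" by (simp add: S_def vec_eq_iff)
  qed
  obtain C where C: "linear C" "\<And>v. v \<in> S \<Longrightarrow> C (laplacian A *v v) = v"
    using linear_exists_left_inverse_on[OF matrix_vector_mul_linear S inj] by blast
  have "C (laplacian A *v w) $ i = w $ i - w $ r" for w i
  proof -
    have "laplacian A *v w = laplacian A *v (\<chi> i. w $ i - w $ r)"
      by (simp add: vec_eq_iff laplacian_mult_vec)
    moreover have "(\<chi> i. w $ i - w $ r) \<in> S" by (simp add: S_def)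
    ultimately show ?thesis using C(2) by simp
  qed
  with C(1) show ?thesis by blast
qed

end

section \<open>The inclusion in integrated form\<close>

context rooted_weights
begin

text \<open>
  The inclusion integrated over \<open>[s, t]\<close>: if \<open>y' = - L w\<close> with \<open>w\<^sub>i\<close> in the Filippov map of \<open>f\<close> at
  \<open>y\<^sub>i\<close>, then \<open>z\<close> stands for a primitive of \<open>w\<close> up to a function that is common to all nodes. Only
  differences \<open>z\<^sub>i - z\<^sub>j\<close> occur, and \<open>w\<close> enters only through the bounds \<open>f \<alpha> \<le> w\<^sub>i\<close> and
  \<open>w\<^sub>j \<le> f \<gamma>\<close>, so that no derivative has to exist and uniform limits inherit the property.
\<close>
definition averaged_solution ::
    "(real \<Rightarrow> real) \<Rightarrow> real set \<Rightarrow> (real \<Rightarrow> real ^ 'n) \<Rightarrow> (real \<Rightarrow> real ^ 'n) \<Rightarrow> bool" where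
  "averaged_solution f J y z \<longleftrightarrow>
     continuous_on J y \<and>
     (\<forall>s\<in>J. \<forall>t\<in>J. s \<le> t \<longrightarrow>
        (\<forall>i. y t $ i - y s $ i =
           (\<Sum>j\<in>UNIV. A $ i $ j * ((z t $ j - z s $ j) - (z t $ i - z s $ i)))) \<and>
        (\<forall>i j \<alpha> \<gamma>. (\<forall>u\<in>{s..t}. \<alpha> < y u $ i) \<longrightarrow> (\<forall>u\<in>{s..t}. y u $ j < \<gamma>) \<longrightarrow>
           (t - s) * (f \<alpha> - f \<gamma>) \<le> (z t $ i - z s $ i) - (z t $ j - z s $ j)))"

lemma averaged_solution_subset:
  "averaged_solution f J y z \<Longrightarrow> I \<subseteq> J \<Longrightarrow> averaged_solution f I y z"
  unfolding averaged_solution_def by (blast intro: continuous_on_subset)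

lemma averaged_solution_increment:
  assumes "averaged_solution f J y z" "s \<in> J" "t \<in> J" "s \<le> t"
  shows "y t $ i - y s $ i = (\<Sum>j\<in>UNIV. A $ i $ j * ((z t - z s) $ j - (z t - z s) $ i))"
  using assms unfolding averaged_solution_def by simp

lemma averaged_solution_order:
  assumes "averaged_solution f J y z" "s \<in> J" "t \<in> J" "s \<le> t"
    and "\<And>u. u \<in> {s..t} \<Longrightarrow> \<alpha> < y u $ i" "\<And>u. u \<in> {s..t} \<Longrightarrow> y u $ j < \<gamma>"
  shows "(t - s) * (f \<alpha> - f \<gamma>) \<le> (z t - z s) $ i - (z t - z s) $ j"
  using assms unfolding averaged_solution_def by simp

text \<open>
  The reflection \<open>y \<mapsto> - y\<close> exchanges maxima and minima and preserves monotonicity of \<open>f\<close>.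
\<close>
lemma averaged_solution_reflect:
  assumes "averaged_solution f J y z"
  shows "averaged_solution (\<lambda>s. - f (- s)) J (\<lambda>t. - y t) (\<lambda>t. - z t)"
  unfolding averaged_solution_def
proof (intro conjI ballI allI impI)
  show "continuous_on J (\<lambda>t. - y t)"
    using assms by (auto simp: averaged_solution_def intro: continuous_on_minus)
  fix s t assume st: "s \<in> J" "t \<in> J" "s \<le> t"
  show "(- y t) $ i - (- y s) $ i =
      (\<Sum>j\<in>UNIV. A $ i $ j * (((- z t) $ j - (- z s) $ j) - ((- z t) $ i - (- z s) $ i)))" for i
    using averaged_solution_increment[OF assms st, of i]
    by (simp add: algebra_simps sum_subtractf sum.distrib)
  fix i j \<alpha> \<gamma>
  assume "\<forall>u\<in>{s..t}. \<alpha> < (- y u) $ i" "\<forall>u\<in>{s..t}. (- y u) $ j < \<gamma>"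
  then show "(t - s) * (- f (- \<alpha>) - - f (- \<gamma>)) \<le> ((- z t) $ i - (- z s) $ i) - ((- z t) $ j - (- z s) $ j)"
    using averaged_solution_order[OF assms st, of "- \<gamma>" j i "- \<alpha>"]
    by (auto simp: minus_less_iff less_minus_iff)
qed


text \<open>
  Both parts bound increments of linear functionals of \<open>x\<close>, whose derivative is known almost
  everywhere from some selection \<open>w\<close>; the selections at different times need not be related.
\<close>
lemma inclusion_solution_averaged:
  assumes sol: "complete_solution (consensus_rhs (laplacian A) f) x" and f: "mono f"
    and C: "linear C" "\<And>w i. C (laplacian A *v w) $ i = w $ r - w $ i" and "0 \<le> a"
  shows "averaged_solution f {a..b} x (\<lambda>t. C (x t))"
proof -
  have ac: "absolutely_continuous_on {s..t} x" if "0 \<le> s" for s t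
    using sol that unfolding inclusion_solution_def locally_absolutely_continuous_on_def by auto
  have "AE t in lebesgue. t \<in> {0..} \<longrightarrow> (\<exists>v\<in>consensus_rhs (laplacian A) f (x t).
      (x has_vector_derivative v) (at t within {0..}))"
    using sol by (simp add: inclusion_solution_def)
  then obtain N where N: "N \<in> null_sets lebesgue"
    "\<And>t. t \<in> space lebesgue - N \<Longrightarrow> t \<in> {0..} \<longrightarrow> (\<exists>v\<in>consensus_rhs (laplacian A) f (x t).
      (x has_vector_derivative v) (at t within {0..}))"
    by (rule AE_E3) blast
  have increment: "h (x t) - h (x s) \<le> c * (t - s)"
    if h: "linear h" and s: "0 \<le> s" "s \<le> t"
      and le: "\<And>u w. u \<in> {s..t} \<Longrightarrow> (\<And>i. w $ i \<in> filippov_map f (x u $ i)) \<Longrightarrow> h (- (laplacian A *v w)) \<le> c"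
    for h :: "real ^ 'n \<Rightarrow> real" and s t c
  proof (rule absolutely_continuous_on_increment_le[OF _ s(2) N(1)])
    have bl: "bounded_linear h" using h by (simp add: linear_conv_bounded_linear)
    show "absolutely_continuous_on {s..t} (\<lambda>u. h (x u))"
      by (rule absolutely_continuous_on_bounded_linear[OF ac[OF s(1)] bl])
    fix u assume u: "u \<in> {s..t} - N"
    then obtain w where w: "\<And>i. w $ i \<in> filippov_map f (x u $ i)"
      "(x has_vector_derivative (- (laplacian A *v w))) (at u within {0..})"
      using N(2)[of u] s(1) unfolding consensus_rhs_def by auto
    have "(x has_vector_derivative (- (laplacian A *v w))) (at u within {s..t})"
      using w(2) by (rule has_vector_derivative_within_subset) (use s in auto)
    then have "((\<lambda>u. h (x u)) has_vector_derivative h (- (laplacian A *v w))) (at u within {s..t})"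
      by (rule bounded_linear.has_vector_derivative[OF bl])
    moreover have "h (- (laplacian A *v w)) \<le> c" using le[of u w] u w(1) by auto
    ultimately show "\<exists>d\<le>c. ((\<lambda>u. h (x u)) has_vector_derivative d) (at u within {s..t})" by blast
  qed
  have Cneg: "C (- v) = - C v" for v using C(1) by (rule linear_neg)
  show ?thesis
    unfolding averaged_solution_def
  proof (intro conjI ballI allI impI)
    show "continuous_on {a..b} x" by (rule absolutely_continuous_on_imp_continuous_on[OF ac[OF \<open>0 \<le> a\<close>]])
    fix s t assume "s \<in> {a..b}" "t \<in> {a..b}" "s \<le> t"
    with \<open>0 \<le> a\<close> have s: "0 \<le> s" "s \<le> t" by auto
    fix i
    define h where "h v = v $ i - (\<Sum>j\<in>UNIV. A $ i $ j * (C v $ j - C v $ i))" for v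
    have h: "linear h"
      unfolding h_def by (rule linearI)
        (simp_all add: linear_add[OF C(1)] linear_scale[OF C(1)] algebra_simps sum.distrib sum_subtractf sum_distrib_left)
    have h0: "h (- (laplacian A *v w)) = 0" for w
      by (simp add: h_def laplacian_mult_vec Cneg C(2) algebra_simps sum_subtractf)
    have "h (x t) - h (x s) \<le> 0 * (t - s)"
      using h s by (rule increment) (simp add: h0)
    moreover have "(\<lambda>v. - h v) (x t) - (\<lambda>v. - h v) (x s) \<le> 0 * (t - s)"
    proof (rule increment[OF _ s])
      show "linear (\<lambda>v. - h v)" using h by (rule linear_compose_neg)
    qed (simp add: h0)
    ultimately have "h (x t) = h (x s)" by simp
    then show "x t $ i - x s $ i =
        (\<Sum>j\<in>UNIV. A $ i $ j * ((C (x t) $ j - C (x s) $ j) - (C (x t) $ i - C (x s) $ i)))"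
      by (simp add: h_def algebra_simps sum_subtractf sum.distrib)
    fix j \<alpha> \<gamma>
    assume \<alpha>: "\<forall>u\<in>{s..t}. \<alpha> < x u $ i" and \<gamma>: "\<forall>u\<in>{s..t}. x u $ j < \<gamma>"
    have "(\<lambda>v. C v $ j - C v $ i) (x t) - (\<lambda>v. C v $ j - C v $ i) (x s) \<le> (f \<gamma> - f \<alpha>) * (t - s)"
    proof (rule increment[OF _ s])
      show "linear (\<lambda>v. C v $ j - C v $ i)"
        by (rule linearI) (simp_all add: linear_add[OF C(1)] linear_scale[OF C(1)] algebra_simps)
      fix u w assume u: "u \<in> {s..t}" and w: "\<And>i. w $ i \<in> filippov_map f (x u $ i)"
      have "f \<alpha> \<le> w $ i" using \<alpha> u by (intro filippov_map_bounds(1)[OF f w, of \<alpha> i "x u $ i + 1"]) auto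
      moreover have "w $ j \<le> f \<gamma>"
        using \<gamma> u by (intro filippov_map_bounds(2)[OF f w, of "x u $ j - 1"]) auto
      ultimately show "C (- (laplacian A *v w)) $ j - C (- (laplacian A *v w)) $ i \<le> f \<gamma> - f \<alpha>"
        by (simp add: Cneg C(2))
    qed
    then show "(t - s) * (f \<alpha> - f \<gamma>) \<le> (C (x t) $ i - C (x s) $ i) - (C (x t) $ j - C (x s) $ j)"
      by (simp add: algebra_simps)
  qed
qed

end

section \<open>Monotonicity of the extreme values\<close>

text \<open>
  Going back in time from \<open>b\<close>, the values can be kept at or above \<open>g b\<close>; the earliest time at which
  \<open>g\<close> is at least \<open>g b\<close> must therefore be \<open>a\<close>. The hypothesis speaks only of times at which \<open>g\<close> is
  at least \<open>g b\<close>, so that it can be verified by arguments valid above some level.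
\<close>
lemma left_increase_imp_le:
  fixes g :: "real \<Rightarrow> real"
  assumes cont: "continuous_on {a..b} g" and "a \<le> b"
    and left: "\<And>t. t \<in> {a<..b} \<Longrightarrow> g b \<le> g t \<Longrightarrow> \<exists>s\<in>{a..<t}. g t \<le> g s"
  shows "g b \<le> g a"
proof -
  define S where "S = {t\<in>{a..b}. g b \<le> g t}"
  have "closed S"
    unfolding S_def by (intro continuous_on_closed_Collect_le continuous_on_const cont) auto
  moreover have S: "S \<noteq> {}" "bdd_below S" using \<open>a \<le> b\<close> by (auto simp: S_def intro: bdd_belowI[of _ a])
  ultimately have I: "Inf S \<in> S" by (intro closed_contains_Inf)
  have "Inf S = a"
  proof (rule ccontr)
    assume "Inf S \<noteq> a"
    with I have "Inf S \<in> {a<..b}" "g b \<le> g (Inf S)" by (auto simp: S_def)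
    then obtain s where s: "s \<in> {a..<Inf S}" "g (Inf S) \<le> g s" using left by blast
    with I have "s \<in> S" by (auto simp: S_def)
    then show False using s cInf_lower[OF _ S(2)] by fastforce
  qed
  with I show ?thesis by (simp add: S_def)
qed

lemma short_left_window:
  fixes y :: "real \<Rightarrow> real ^ 'n::finite"
  assumes "continuous_on {a..b} y" "t \<in> {a<..b}" "\<epsilon> > 0"
  obtains s where "s \<in> {a..<t}" "\<And>u i. u \<in> {s..t} \<Longrightarrow> \<bar>y u $ i - y t $ i\<bar> < \<epsilon>"
proof -
  have "t \<in> {a..b}" using assms(2) by auto
  then obtain d where d: "d > 0" "\<And>u. u \<in> {a..b} \<Longrightarrow> dist u t < d \<Longrightarrow> dist (y u) (y t) < \<epsilon>"
    using assms(1,3) unfolding continuous_on_iff by meson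
  have "\<bar>y u $ i - y t $ i\<bar> < \<epsilon>" if "u \<in> {max a (t - d / 2)..t}" for u i
  proof -
    have "dist (y u) (y t) < \<epsilon>" using that d(1) assms(2) by (intro d(2)) (auto simp: dist_real_def)
    then show ?thesis using component_le_norm_cart[of "y u - y t" i] by (auto simp: dist_norm)
  qed
  then show thesis using that[of "max a (t - d / 2)"] d(1) assms(2) by auto
qed

lemma gap_below:
  fixes v :: "real ^ 'n::finite"
  assumes "c0 < M"
  obtains c where "c0 < c" "c < M" "\<And>j. v $ j < M \<Longrightarrow> v $ j < c"
proof -
  have fin: "finite (insert c0 {v $ j |j. v $ j < M})" by simp
  then have "Max (insert c0 {v $ j |j. v $ j < M}) < M" using assms by (subst Max_less_iff) auto
  then obtain c where c: "Max (insert c0 {v $ j |j. v $ j < M}) < c" "c < M" using dense by blast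
  have le: "x \<le> Max (insert c0 {v $ j |j. v $ j < M})" if "x \<in> insert c0 {v $ j |j. v $ j < M}" for x
    using fin that by (rule Max_ge)
  have "v $ j < c" if "v $ j < M" for j
    using le[of "v $ j"] that c(1) by auto
  moreover have "c0 < c" using le[of c0] c(1) by auto
  ultimately show thesis using that c(2) by blast
qed

context rooted_weights
begin

text \<open>
  In a short window before \<open>t\<close> the nodes at the maximum \<open>M\<close> stay above \<open>c\<close> and the others below, so the
  former have \<open>z\<close>-increments at least as large as the latter. Hence a node with the largest increment among the
  former has the largest increment of all.
\<close>
lemma left_window_at_max:
  assumes avg: "averaged_solution f {a..b} y z" and t: "t \<in> {a<..b}"
    and i0: "y t $ i0 = M"
    and c: "c < M" "\<forall>j. y t $ j < c \<or> y t $ j = M" and "\<epsilon> > 0"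
  shows "\<exists>s\<in>{a..<t}. (\<forall>u\<in>{s..t}. \<forall>k. \<bar>y u $ k - y t $ k\<bar> < \<epsilon>) \<and>
    (\<forall>j. y t $ j \<noteq> M \<longrightarrow> (\<forall>u\<in>{s..t}. y u $ j < c)) \<and>
    (\<exists>i. y t $ i = M \<and> (\<forall>l. (z t - z s) $ l \<le> (z t - z s) $ i))"
proof -
  have cont: "continuous_on {a..b} y" using avg by (simp add: averaged_solution_def)
  obtain c1 where c1: "c1 < c" "\<And>j. y t $ j < c \<Longrightarrow> y t $ j < c1"
    using gap_below[of "c - 1" c "y t"] by auto
  \<comment> \<open>A deviation below this size keeps both groups of nodes on their side of the level c.\<close>
  define \<eta> where "\<eta> = min \<epsilon> (min (M - c) (c - c1))"
  have "\<eta> > 0" using c c1 \<open>\<epsilon> > 0\<close> by (simp add: \<eta>_def)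
  then obtain s where s: "s \<in> {a..<t}" "\<And>u i. u \<in> {s..t} \<Longrightarrow> \<bar>y u $ i - y t $ i\<bar> < \<eta>"
    using short_left_window[OF cont t, of \<eta>] by blast
  define w where "w = z t - z s"
  have low: "y u $ j < c" if "y t $ j \<noteq> M" "u \<in> {s..t}" for j u
  proof -
    have "y t $ j < c" using c(2) that(1) by blast
    then have "y t $ j < c1" by (rule c1(2))
    then show ?thesis using s(2)[OF that(2), of j] by (auto simp: \<eta>_def)
  qed
  have high: "c < y u $ i" if "y t $ i = M" "u \<in> {s..t}" for i u
    using s(2)[OF that(2), of i] that(1) by (auto simp: \<eta>_def)
  have "Max (($) w ` {i. y t $ i = M}) \<in> ($) w ` {i. y t $ i = M}"
    using i0 by (intro Max_in) auto
  then obtain i where i: "y t $ i = M" "Max (($) w ` {i. y t $ i = M}) = w $ i" by blast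
  have top: "w $ l \<le> w $ i" if "y t $ l = M" for l
    unfolding i(2)[symmetric] using that by (intro Max_ge) auto
  have "w $ l \<le> w $ i" for l
  proof (cases "y t $ l = M")
    case False
    have "(t - s) * (f c - f c) \<le> w $ i - w $ l"
      unfolding w_def using s(1) t by (intro averaged_solution_order[OF avg] high low i False) auto
    then show ?thesis by simp
  qed (rule top)
  then have "y t $ i = M \<and> (\<forall>l. (z t - z s) $ l \<le> (z t - z s) $ i)" using i(1) by (simp add: w_def)
  moreover have "\<forall>u\<in>{s..t}. \<forall>k. \<bar>y u $ k - y t $ k\<bar> < \<epsilon>" using s(2) by (simp add: \<eta>_def)
  ultimately show ?thesis using s(1) low by blast
qed

definition node_max :: "real ^ 'n \<Rightarrow> real" where
  "node_max v = Max (range (($) v))"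

lemma le_node_max: "v $ i \<le> node_max v"
  unfolding node_max_def by (intro Max_ge) auto

lemma node_max_attained: "\<exists>i. v $ i = node_max v"
proof -
  have "Max (range (($) v)) \<in> range (($) v)" by (intro Max_in) auto
  then show ?thesis unfolding node_max_def by (metis rangeE)
qed

lemma node_max_diff_le: "node_max v - node_max w \<le> norm (v - w)"
proof -
  obtain i where "v $ i = node_max v" using node_max_attained by blast
  then show ?thesis
    using le_node_max[of w i] component_le_norm_cart[of "v - w" i] by auto
qed

lemma continuous_node_max: "continuous_on S node_max"
proof (rule continuous_onI)
  fix v e assume "0 < (e::real)"
  moreover have "dist (node_max w) (node_max v) \<le> dist w v" for w
    using node_max_diff_le[of v w] node_max_diff_le[of w v]
    by (auto simp: dist_real_def dist_norm norm_minus_commute)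
  ultimately show "\<exists>d>0. \<forall>w\<in>S. dist w v < d \<longrightarrow> dist (node_max w) (node_max v) \<le> e"
    by (meson less_imp_le order_trans)
qed

text \<open>
  The coupling does not push the node found by \<open>left_window_at_max\<close> upwards, so shortly before \<open>t\<close> it
  was at least as high as the maximum at \<open>t\<close>. Looking to the left of \<open>t\<close> is what makes this work: to
  the right of \<open>t\<close> the node with the largest increment need not be the one that rises.
\<close>
lemma node_max_nonincreasing:
  assumes avg: "averaged_solution f {a..b} y z" and "a \<le> b"
  shows "node_max (y b) \<le> node_max (y a)"
proof (rule left_increase_imp_le[OF _ \<open>a \<le> b\<close>])
  have "continuous_on {a..b} y" using avg by (simp add: averaged_solution_def)
  then show "continuous_on {a..b} (\<lambda>t. node_max (y t))"
    by (rule continuous_on_compose2[OF continuous_node_max[of UNIV]]) auto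
next
  fix t assume t: "t \<in> {a<..b}"
  define M where "M = node_max (y t)"
  obtain i0 where i0: "y t $ i0 = M" using node_max_attained M_def by blast
  obtain c where c: "c < M" "\<And>j. y t $ j < M \<Longrightarrow> y t $ j < c"
    using gap_below[of "M - 1" M "y t"] by auto
  have c': "\<forall>j. y t $ j < c \<or> y t $ j = M"
  proof
    fix j
    show "y t $ j < c \<or> y t $ j = M"
      using c(2)[of j] le_node_max[of "y t" j] unfolding M_def by linarith
  qed
  obtain s i where s: "s \<in> {a..<t}" "y t $ i = M" "\<forall>l. (z t - z s) $ l \<le> (z t - z s) $ i"
    using left_window_at_max[OF avg t i0 c(1) c' zero_less_one] by blast
  have "y t $ i - y s $ i = (\<Sum>j\<in>UNIV. A $ i $ j * ((z t - z s) $ j - (z t - z s) $ i))"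
    using s(1) t by (intro averaged_solution_increment[OF avg]) auto
  also have "\<dots> \<le> 0" using s(3) by (intro coupling_nonpos_at_max) simp
  finally have "M \<le> node_max (y s)" using s(2) le_node_max[of "y s" i] by simp
  with s(1) show "\<exists>s\<in>{a..<t}. node_max (y t) \<le> node_max (y s)" by (auto simp: M_def)
qed

end

section \<open>Solutions with constant extreme values\<close>

context rooted_weights
begin

text \<open>
  When \<open>M\<close> bounds the whole history, no node at \<open>M\<close> at time \<open>t\<close> has come down, so the coupling sum of
  such a node is nonnegative. If only nodes at \<open>M\<close> had the largest \<open>z\<close>-increment, the maximum
  principle would put the root at \<open>M\<close>. So some node below \<open>M\<close> has the largest increment as well.
\<close>
lemma left_window_below_max:
  assumes avg: "averaged_solution f {a..b} y z" and t: "t \<in> {a<..b}"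
    and le: "\<forall>u\<in>{a..b}. \<forall>k. y u $ k \<le> M" and i0: "y t $ i0 = M" and r: "y t $ r < M"
    and c: "c < M" "\<forall>j. y t $ j < c \<or> y t $ j = M" and "\<epsilon> > 0"
  shows "\<exists>s\<in>{a..<t}. (\<forall>u\<in>{s..t}. \<forall>k. \<bar>y u $ k - y t $ k\<bar> < \<epsilon>) \<and>
    (\<exists>i. y t $ i = M \<and> (\<forall>l. (z t - z s) $ l \<le> (z t - z s) $ i)) \<and>
    (\<exists>j. (\<forall>u\<in>{s..t}. y u $ j < c) \<and> (\<forall>l. (z t - z s) $ l \<le> (z t - z s) $ j))"
proof -
  obtain s i where s: "s \<in> {a..<t}" "\<forall>u\<in>{s..t}. \<forall>k. \<bar>y u $ k - y t $ k\<bar> < \<epsilon>"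
    "\<forall>j. y t $ j \<noteq> M \<longrightarrow> (\<forall>u\<in>{s..t}. y u $ j < c)"
    "y t $ i = M" "\<forall>l. (z t - z s) $ l \<le> (z t - z s) $ i"
    using left_window_at_max[OF avg t i0 c \<open>\<epsilon> > 0\<close>] by blast
  have "\<exists>j. y t $ j \<noteq> M \<and> (\<forall>l. (z t - z s) $ l \<le> (z t - z s) $ j)"
  proof (rule ccontr)
    assume neg: "\<not> ?thesis"
    have "r \<in> {k. y t $ k = M}"
    proof (rule root_attains_max(1)[of i _ "z t - z s"])
      fix k assume "\<And>j. (z t - z s) $ j \<le> (z t - z s) $ k"
      with neg have k: "y t $ k = M" by blast
      have "y t $ k - y s $ k = (\<Sum>j\<in>UNIV. A $ k $ j * ((z t - z s) $ j - (z t - z s) $ k))"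
        using s(1) t by (intro averaged_solution_increment[OF avg]) auto
      moreover have "y s $ k \<le> M" using s(1) t le by auto
      ultimately show "k \<in> {k. y t $ k = M} \<and>
          0 \<le> (\<Sum>j\<in>UNIV. A $ k $ j * ((z t - z s) $ j - (z t - z s) $ k))"
        using k by simp
    qed (use s in auto)
    with r show False by simp
  qed
  with s show ?thesis by blast
qed

text \<open>
  A node below \<open>c\<close> cannot match the \<open>z\<close>-increment of a node close to \<open>M\<close> unless \<open>f\<close> has the same
  value at \<open>c\<close> and close to \<open>M\<close>.
\<close>
lemma constant_below_max:
  assumes avg: "averaged_solution f {a..b} y z" and f: "mono f" and t: "t \<in> {a<..b}"
    and le: "\<forall>u\<in>{a..b}. \<forall>k. y u $ k \<le> M" and i0: "y t $ i0 = M" and r: "y t $ r < M"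
  shows "\<exists>\<beta><M. \<forall>v\<in>{\<beta>..<M}. f v = f \<beta>"
proof -
  obtain c where c: "M - 1 < c" "c < M" "\<And>j. y t $ j < M \<Longrightarrow> y t $ j < c"
    using gap_below[of "M - 1" M "y t"] by auto
  have c': "\<forall>j. y t $ j < c \<or> y t $ j = M"
  proof
    fix j
    have "y t $ j \<le> M" using le t by auto
    then show "y t $ j < c \<or> y t $ j = M" using c(3)[of j] by linarith
  qed
  have "f v = f c" if v: "c \<le> v" "v < M" for v
  proof -
    have "M - v > 0" using v by simp
    then obtain s i j where s: "s \<in> {a..<t}" "\<forall>u\<in>{s..t}. \<forall>k. \<bar>y u $ k - y t $ k\<bar> < M - v"
      "y t $ i = M" "\<forall>u\<in>{s..t}. y u $ j < c" "\<forall>l. (z t - z s) $ l \<le> (z t - z s) $ j"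
      using left_window_below_max[OF avg t le i0 r c(2) c', of "M - v"] by blast
    have "(t - s) * (f v - f c) \<le> (z t - z s) $ i - (z t - z s) $ j"
    proof (rule averaged_solution_order[OF avg])
      show "v < y u $ i" if "u \<in> {s..t}" for u using s(2)[rule_format, OF that, of i] s(3) by linarith
      show "y u $ j < c" if "u \<in> {s..t}" for u using s(4) that by blast
    qed (use s(1) t in auto)
    also have "\<dots> \<le> 0" using s(5) by simp
    finally have "f v \<le> f c" using s(1) by (auto simp: mult_le_0_iff)
    moreover have "f c \<le> f v" using f v by (auto intro: monoD)
    ultimately show ?thesis by simp
  qed
  then have "\<forall>v\<in>{c..<M}. f v = f c" by (simp only: atLeastLessThan_iff Ball_def) blast
  with c(2) show ?thesis by blast
qed

text \<open>
  Where \<open>f\<close> is constant below \<open>M\<close>, every node above the level \<open>\<beta>\<close> has at least the \<open>z\<close>-increment of the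
  node below \<open>M\<close> found by \<open>left_window_below_max\<close>, which is the largest one; so the coupling cannot push
  it upwards.
\<close>
lemma left_increase_above_constant:
  assumes avg: "averaged_solution f {a..b} y z" and t: "t \<in> {a<..b}"
    and le: "\<forall>u\<in>{a..b}. \<forall>k. y u $ k \<le> M" and i0: "y t $ i0 = M" and r: "y t $ r < M"
    and const: "\<beta> < M" "\<forall>v\<in>{\<beta>..<M}. f v = f \<beta>" and k: "\<beta> < y t $ k"
  shows "\<exists>s\<in>{a..<t}. y t $ k \<le> y s $ k"
proof -
  obtain c where c: "\<beta> < c" "c < M" "\<And>j. y t $ j < M \<Longrightarrow> y t $ j < c"
    using gap_below[of \<beta> M "y t"] const(1) by auto
  have c': "\<forall>j. y t $ j < c \<or> y t $ j = M"
  proof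
    fix j
    have "y t $ j \<le> M" using le t by auto
    then show "y t $ j < c \<or> y t $ j = M" using c(3)[of j] by linarith
  qed
  have "y t $ k - \<beta> > 0" using k by simp
  then obtain s j where s: "s \<in> {a..<t}" "\<forall>u\<in>{s..t}. \<forall>l. \<bar>y u $ l - y t $ l\<bar> < y t $ k - \<beta>"
    "\<forall>u\<in>{s..t}. y u $ j < c" "\<forall>l. (z t - z s) $ l \<le> (z t - z s) $ j"
    using left_window_below_max[OF avg t le i0 r c(2) c', of "y t $ k - \<beta>"] by blast
  have "(t - s) * (f \<beta> - f c) \<le> (z t - z s) $ k - (z t - z s) $ j"
  proof (rule averaged_solution_order[OF avg])
    show "\<beta> < y u $ k" if "u \<in> {s..t}" for u using s(2)[rule_format, OF that, of k] by linarith
    show "y u $ j < c" if "u \<in> {s..t}" for u using s(3) that by blast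
  qed (use s(1) t in auto)
  moreover have "f c = f \<beta>" using const(2)[rule_format, of c] c(1,2) by (simp only: atLeastLessThan_iff less_imp_le)
  ultimately have "(z t - z s) $ l \<le> (z t - z s) $ k" for l using s(4)[rule_format, of l] by simp
  then have "(\<Sum>j\<in>UNIV. A $ k $ j * ((z t - z s) $ j - (z t - z s) $ k)) \<le> 0"
    by (rule coupling_nonpos_at_max)
  moreover have "y t $ k - y s $ k = (\<Sum>j\<in>UNIV. A $ k $ j * ((z t - z s) $ j - (z t - z s) $ k))"
    using s(1) t by (intro averaged_solution_increment[OF avg]) auto
  ultimately have "y t $ k \<le> y s $ k" by linarith
  then show ?thesis using s(1) by blast
qed

text \<open>
  To arrive at \<open>M\<close>, the root would have to cross the flat part of \<open>f\<close> below \<open>M\<close>, where no node can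
  increase as long as the root is below \<open>M\<close>.
\<close>
lemma root_stays_below_max:
  assumes avg: "averaged_solution f {a..b} y z" and f: "mono f"
    and le: "\<forall>u\<in>{a..b}. \<forall>k. y u $ k \<le> M" and att: "\<forall>u\<in>{a..b}. \<exists>i. y u $ i = M"
    and r: "y a $ r < M" and t: "t \<in> {a..b}"
  shows "y t $ r < M"
proof (rule ccontr)
  assume "\<not> y t $ r < M"
  have cont: "continuous_on {a..b} y" using avg by (simp add: averaged_solution_def)
  have contr: "continuous_on {a..b} (\<lambda>t. y t $ r)" by (intro continuous_intros cont)
  define Z where "Z = {u\<in>{a..b}. M \<le> y u $ r}"
  have "closed Z"
    unfolding Z_def by (intro continuous_on_closed_Collect_le continuous_on_const contr) auto
  moreover have Z: "Z \<noteq> {}" "bdd_below Z"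
    using t \<open>\<not> y t $ r < M\<close> by (auto simp: Z_def intro: bdd_belowI[of _ a])
  ultimately have \<tau>: "Inf Z \<in> Z" by (intro closed_contains_Inf)
  define \<tau> where "\<tau> = Inf Z"
  have \<tau>ab: "\<tau> \<in> {a<..b}" "M \<le> y \<tau> $ r" using \<tau> r by (auto simp: Z_def \<tau>_def order_less_le)
  have below: "y u $ r < M" if "u \<in> {a..<\<tau>}" for u
    using cInf_lower[OF _ Z(2), of u] that \<tau>ab by (force simp: Z_def \<tau>_def)
  \<comment> \<open>Any time strictly before the first arrival of the root at M provides the flat part.\<close>
  have mid: "(a + \<tau>) / 2 \<in> {a<..b}" "(a + \<tau>) / 2 \<in> {a..b}" "(a + \<tau>) / 2 \<in> {a..<\<tau>}"
    using \<tau>ab by auto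
  obtain i where i: "y ((a + \<tau>) / 2) $ i = M" using att mid(2) by blast
  obtain \<beta> where \<beta>: "\<beta> < M" "\<forall>v\<in>{\<beta>..<M}. f v = f \<beta>"
    using constant_below_max[OF avg f mid(1) le i below[OF mid(3)]] by blast
  have "M - max \<beta> (y a $ r) > 0" using \<beta> r by simp
  then obtain s where s: "s \<in> {a..<\<tau>}" "\<And>u i. u \<in> {s..\<tau>} \<Longrightarrow> \<bar>y u $ i - y \<tau> $ i\<bar> < M - max \<beta> (y a $ r)"
    using short_left_window[OF cont \<tau>ab(1), of "M - max \<beta> (y a $ r)"] by blast
  have sr: "max \<beta> (y a $ r) < y s $ r"
    using s(2)[of s r] s(1) \<tau>ab by auto
  have "y s $ r \<le> y a $ r"
  proof (rule left_increase_imp_le[of a s "\<lambda>u. y u $ r"])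
    show "continuous_on {a..s} (\<lambda>t. y t $ r)"
      using s(1) \<tau>ab by (intro continuous_on_subset[OF contr]) auto
    fix u assume u: "u \<in> {a<..s}" "y s $ r \<le> y u $ r"
    then have ub: "u \<in> {a<..b}" "u \<in> {a..b}" "u \<in> {a..<\<tau>}" using s(1) \<tau>ab by auto
    obtain i where i: "y u $ i = M" using att ub(2) by blast
    have "\<beta> < y u $ r" using u(2) sr by simp
    then show "\<exists>v\<in>{a..<u}. y u $ r \<le> y v $ r"
      by (rule left_increase_above_constant[OF avg ub(1) le i below[OF ub(3)] \<beta>])
  qed (use s in auto)
  with sr show False by simp
qed

text \<open>
  The node is chosen at the final time \<open>b\<close> and followed backwards: in the flat part of \<open>f\<close> it was
  never lower before, and \<open>M\<close> is an upper bound.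
\<close>
lemma node_stays_at_max:
  assumes avg: "averaged_solution f {a..b} y z" and f: "mono f" and "a < b"
    and le: "\<forall>u\<in>{a..b}. \<forall>k. y u $ k \<le> M" and att: "\<forall>u\<in>{a..b}. \<exists>i. y u $ i = M"
    and r: "y a $ r < M"
  shows "\<exists>i. \<forall>t\<in>{a..b}. y t $ i = M"
proof -
  have cont: "continuous_on {a..b} y" using avg by (simp add: averaged_solution_def)
  have below: "y t $ r < M" if "t \<in> {a..b}" for t
    by (rule root_stays_below_max[OF avg f le att r that])
  obtain i where i: "y b $ i = M" using att \<open>a < b\<close> by fastforce
  have ends: "b \<in> {a<..b}" "b \<in> {a..b}" using \<open>a < b\<close> by auto
  then obtain \<beta> where \<beta>: "\<beta> < M" "\<forall>v\<in>{\<beta>..<M}. f v = f \<beta>"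
    using constant_below_max[OF avg f ends(1) le i below[OF ends(2)]] by blast
  have "y t $ i = M" if t: "t \<in> {a..b}" for t
  proof -
    have "y b $ i \<le> y t $ i"
    proof (rule left_increase_imp_le[of t b "\<lambda>u. y u $ i"])
      show "continuous_on {t..b} (\<lambda>t. y t $ i)"
        using t by (intro continuous_intros continuous_on_subset[OF cont]) auto
      fix u assume u: "u \<in> {t<..b}" "y b $ i \<le> y u $ i"
      have "averaged_solution f {t..b} y z" using t by (intro averaged_solution_subset[OF avg]) auto
      moreover have "y u $ i = M" using u i t le[rule_format, of u i] by auto
      moreover have "y u $ r < M" using u t by (intro below) auto
      moreover have "\<forall>v\<in>{t..b}. \<forall>k. y v $ k \<le> M" using le t by auto
      moreover have "\<beta> < y u $ i" using \<open>y u $ i = M\<close> \<beta>(1) by simp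
      ultimately show "\<exists>s\<in>{t..<u}. y u $ i \<le> y s $ i"
        using left_increase_above_constant[OF _ u(1) _ _ _ \<beta>] by blast
    qed (use t in auto)
    with i le[rule_format, OF t, of i] show ?thesis by simp
  qed
  then show ?thesis by blast
qed

lemma root_was_at_max:
  assumes avg: "averaged_solution f {a..b} y z" and f: "mono f"
    and le: "\<forall>u\<in>{a..b}. \<forall>k. y u $ k \<le> M" and att: "\<forall>u\<in>{a..b}. \<exists>i. y u $ i = M"
    and r: "y b $ r = M" and t: "t \<in> {a..b}"
  shows "y t $ r = M"
proof (rule ccontr)
  assume "y t $ r \<noteq> M"
  then have "y t $ r < M" using le t by (auto simp: order_less_le)
  moreover have "averaged_solution f {t..b} y z" using t by (intro averaged_solution_subset[OF avg]) auto
  moreover have "\<forall>u\<in>{t..b}. \<forall>k. y u $ k \<le> M" "\<forall>u\<in>{t..b}. \<exists>i. y u $ i = M" "b \<in> {t..b}"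
    using le att t by auto
  ultimately have "y b $ r < M" using root_stays_below_max[OF _ f] by blast
  with r show False by simp
qed


lemma node_stays_at_min:
  assumes avg: "averaged_solution f {a..b} y z" and f: "mono f" and "a < b"
    and ge: "\<forall>u\<in>{a..b}. \<forall>k. m \<le> y u $ k" and att: "\<forall>u\<in>{a..b}. \<exists>i. y u $ i = m"
    and r: "m < y a $ r"
  shows "\<exists>i. \<forall>t\<in>{a..b}. y t $ i = m"
proof -
  have f': "mono (\<lambda>s. - f (- s))"
    by (rule monoI) (simp add: monoD[OF f])
  have "\<exists>i. \<forall>t\<in>{a..b}. (- y t) $ i = - m"
  proof (rule node_stays_at_max[OF averaged_solution_reflect[OF avg] f' \<open>a < b\<close>])
    show "\<forall>u\<in>{a..b}. \<forall>k. (- y u) $ k \<le> - m" using ge by simp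
    show "\<forall>u\<in>{a..b}. \<exists>i. (- y u) $ i = - m" using att by simp
    show "(- y a) $ r < - m" using r by simp
  qed
  then show ?thesis by simp
qed

lemma root_was_at_min:
  assumes avg: "averaged_solution f {a..b} y z" and f: "mono f"
    and ge: "\<forall>u\<in>{a..b}. \<forall>k. m \<le> y u $ k" and att: "\<forall>u\<in>{a..b}. \<exists>i. y u $ i = m"
    and r: "y b $ r = m" and t: "t \<in> {a..b}"
  shows "y t $ r = m"
proof -
  have f': "mono (\<lambda>s. - f (- s))"
    by (rule monoI) (simp add: monoD[OF f])
  have "(- y t) $ r = - m"
  proof (rule root_was_at_max[OF averaged_solution_reflect[OF avg] f' _ _ _ t])
    show "\<forall>u\<in>{a..b}. \<forall>k. (- y u) $ k \<le> - m" using ge by simp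
    show "\<forall>u\<in>{a..b}. \<exists>i. (- y u) $ i = - m" using att by simp
    show "(- y b) $ r = - m" using r by simp
  qed
  then show ?thesis by simp
qed

text \<open>
  At time \<open>T\<close> the root is at one extreme or strictly in between. In the first case it has been at that
  extreme since time \<open>0\<close>, hence away from the other one, which then keeps some node on the first half; in
  the second case both extremes keep a node on the second half.
\<close>
lemma nodes_stay_at_extremes:
  assumes avg: "averaged_solution f {0..2 * T} y z" and f: "mono f" and "T > 0" and "m < M"
    and le: "\<forall>u\<in>{0..2 * T}. \<forall>k. y u $ k \<le> M" and att: "\<forall>u\<in>{0..2 * T}. \<exists>i. y u $ i = M"
    and ge: "\<forall>u\<in>{0..2 * T}. \<forall>k. m \<le> y u $ k" and att': "\<forall>u\<in>{0..2 * T}. \<exists>i. y u $ i = m"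
  shows "\<exists>p i j. 0 \<le> p \<and> p + T \<le> 2 * T \<and> (\<forall>t\<in>{p..p + T}. y t $ i = M \<and> y t $ j = m)"
proof -
  have sub: "{0..T} \<subseteq> {0..2 * T}" "{T..2 * T} \<subseteq> {0..2 * T}" using \<open>T > 0\<close> by auto
  note avg1 = averaged_solution_subset[OF avg sub(1)] and avg2 = averaged_solution_subset[OF avg sub(2)]
  have b1: "\<forall>u\<in>{0..T}. \<forall>k. y u $ k \<le> M" "\<forall>u\<in>{0..T}. \<exists>i. y u $ i = M"
    "\<forall>u\<in>{0..T}. \<forall>k. m \<le> y u $ k" "\<forall>u\<in>{0..T}. \<exists>i. y u $ i = m"
    using sub(1) le att ge att' by blast+
  have b2: "\<forall>u\<in>{T..2*T}. \<forall>k. y u $ k \<le> M" "\<forall>u\<in>{T..2*T}. \<exists>i. y u $ i = M"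
    "\<forall>u\<in>{T..2*T}. \<forall>k. m \<le> y u $ k" "\<forall>u\<in>{T..2*T}. \<exists>i. y u $ i = m"
    using sub(2) le att ge att' by blast+
  have T: "0 \<in> {0..T}" "0 < T" "T < 2 * T" "T \<in> {0..2 * T}" using \<open>T > 0\<close> by auto
  have mr: "m \<le> y T $ r" "y T $ r \<le> M" using le ge T by auto
  then consider "y T $ r = M" | "y T $ r = m" | "m < y T $ r" "y T $ r < M" by linarith
  then show ?thesis
  proof cases
    case 1
    then have "\<forall>t\<in>{0..T}. y t $ r = M" using root_was_at_max[OF avg1 f b1(1,2)] by blast
    moreover from this have "m < y 0 $ r" using T(1) \<open>m < M\<close> by simp
    then obtain j where "\<forall>t\<in>{0..T}. y t $ j = m"
      using node_stays_at_min[OF avg1 f T(2) b1(3,4)] by blast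
    ultimately show ?thesis using T(2) by (intro exI[of _ 0] exI[of _ r] exI[of _ j]) simp
  next
    case 2
    then have "\<forall>t\<in>{0..T}. y t $ r = m" using root_was_at_min[OF avg1 f b1(3,4)] by blast
    moreover from this have "y 0 $ r < M" using T(1) \<open>m < M\<close> by simp
    then obtain i where "\<forall>t\<in>{0..T}. y t $ i = M"
      using node_stays_at_max[OF avg1 f T(2) b1(1,2)] by blast
    ultimately show ?thesis using T(2) by (intro exI[of _ 0] exI[of _ i] exI[of _ r]) simp
  next
    case 3
    obtain i where "\<forall>t\<in>{T..2*T}. y t $ i = M"
      using node_stays_at_max[OF avg2 f T(3) b2(1,2) 3(2)] by blast
    moreover obtain j where "\<forall>t\<in>{T..2*T}. y t $ j = m"
      using node_stays_at_min[OF avg2 f T(3) b2(3,4) 3(1)] by blast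
    ultimately show ?thesis using T(2) by (intro exI[of _ T] exI[of _ i] exI[of _ j]) simp
  qed
qed

end

section \<open>Limits of time shifts\<close>

context rooted_weights
begin

lemma averaged_solution_shift:
  assumes avg: "averaged_solution f {c + a..c + b} y z"
  shows "averaged_solution f {a..b} (\<lambda>t. y (c + t)) (\<lambda>t. z (c + t))"
  unfolding averaged_solution_def
proof (intro conjI ballI allI impI)
  have "continuous_on {c + a..c + b} y" using avg by (simp add: averaged_solution_def)
  then show "continuous_on {a..b} (\<lambda>t. y (c + t))"
    by (rule continuous_on_compose2) (auto intro!: continuous_intros)
  fix s t assume "s \<in> {a..b}" "t \<in> {a..b}" "s \<le> t"
  then have st: "c + s \<in> {c + a..c + b}" "c + t \<in> {c + a..c + b}" "c + s \<le> c + t" by auto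
  show "y (c + t) $ i - y (c + s) $ i = (\<Sum>j\<in>UNIV. A $ i $ j *
      ((z (c + t) $ j - z (c + s) $ j) - (z (c + t) $ i - z (c + s) $ i)))" for i
    using averaged_solution_increment[OF avg st, of i] by simp
  fix i j \<alpha> \<gamma>
  assume *: "\<forall>u\<in>{s..t}. \<alpha> < y (c + u) $ i" "\<forall>u\<in>{s..t}. y (c + u) $ j < \<gamma>"
  have "(c + t - (c + s)) * (f \<alpha> - f \<gamma>) \<le> (z (c + t) - z (c + s)) $ i - (z (c + t) - z (c + s)) $ j"
  proof (rule averaged_solution_order[OF avg st])
    fix u assume "u \<in> {c + s..c + t}"
    then have "u - c \<in> {s..t}" by auto
    then have "\<alpha> < y (c + (u - c)) $ i" "y (c + (u - c)) $ j < \<gamma>" using * by blast+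
    then show "\<alpha> < y u $ i" "y u $ j < \<gamma>" by simp_all
  qed
  then show "(t - s) * (f \<alpha> - f \<gamma>) \<le>
      (z (c + t) $ i - z (c + s) $ i) - (z (c + t) $ j - z (c + s) $ j)" by simp
qed

text \<open>
  A Lipschitz constant depending only on a bound for the components gives equicontinuity of all time
  shifts of a solution.
\<close>
lemma averaged_solution_lipschitz:
  assumes avg: "averaged_solution f J y z" and st: "s \<in> J" "t \<in> J" "s \<le> t"
    and B: "\<And>u i. u \<in> {s..t} \<Longrightarrow> \<bar>y u $ i\<bar> < B"
  shows "norm (y t - y s) \<le> (\<Sum>i\<in>UNIV. \<Sum>j\<in>UNIV. A $ i $ j) * (f B - f (- B)) * (t - s)"
proof -
  have osc: "(z t - z s) $ i - (z t - z s) $ j \<le> (f B - f (- B)) * (t - s)" for i j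
  proof -
    have "(t - s) * (f (- B) - f B) \<le> (z t - z s) $ j - (z t - z s) $ i"
    proof (rule averaged_solution_order[OF avg st])
      fix u assume u: "u \<in> {s..t}"
      show "- B < y u $ j" "y u $ i < B" using B[OF u, of j] B[OF u, of i] by linarith+
    qed
    then show ?thesis by (simp add: algebra_simps)
  qed
  have "\<bar>(y t - y s) $ i\<bar> \<le> (\<Sum>j\<in>UNIV. A $ i $ j) * ((f B - f (- B)) * (t - s))" for i
  proof -
    have "(y t - y s) $ i = (\<Sum>j\<in>UNIV. A $ i $ j * ((z t - z s) $ j - (z t - z s) $ i))"
      using averaged_solution_increment[OF avg st] by simp
    also have "\<bar>\<dots>\<bar> \<le> (\<Sum>j\<in>UNIV. \<bar>A $ i $ j * ((z t - z s) $ j - (z t - z s) $ i)\<bar>)"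
      by (rule sum_abs)
    also have "\<dots> \<le> (\<Sum>j\<in>UNIV. A $ i $ j * ((f B - f (- B)) * (t - s)))"
    proof (rule sum_mono)
      fix j
      have "\<bar>(z t - z s) $ j - (z t - z s) $ i\<bar> \<le> (f B - f (- B)) * (t - s)"
        using osc[of i j] osc[of j i] by linarith
      then show "\<bar>A $ i $ j * ((z t - z s) $ j - (z t - z s) $ i)\<bar> \<le> A $ i $ j * ((f B - f (- B)) * (t - s))"
        using nonneg[of i j] by (simp only: abs_mult abs_of_nonneg mult_left_mono)
    qed
    finally show ?thesis by (simp only: sum_distrib_right)
  qed
  then have "(\<Sum>i\<in>UNIV. \<bar>(y t - y s) $ i\<bar>) \<le> (\<Sum>i\<in>UNIV. (\<Sum>j\<in>UNIV. A $ i $ j) * ((f B - f (- B)) * (t - s)))"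
    by (intro sum_mono)
  also have "\<dots> = (\<Sum>i\<in>UNIV. \<Sum>j\<in>UNIV. A $ i $ j) * ((f B - f (- B)) * (t - s))"
    by (rule sum_distrib_right[symmetric])
  finally show ?thesis using norm_le_l1_cart[of "y t - y s"] by (simp add: mult.assoc)
qed

text \<open>
  Strict bounds on a compact time interval hold with a positive margin, so they pass from the limit
  to all late members of the sequence.
\<close>
lemma averaged_solution_uniform_limit:
  assumes avg: "\<And>n. averaged_solution f {a..b} (x n) (\<lambda>t. C (x n t))"
    and C: "linear C" and y: "continuous_on {a..b} y"
    and lim: "uniform_limit {a..b} x y sequentially"
  shows "averaged_solution f {a..b} y (\<lambda>t. C (y t))"
  unfolding averaged_solution_def
proof (intro conjI ballI allI impI)
  show "continuous_on {a..b} y" by fact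
  fix s t assume st: "s \<in> {a..b}" "t \<in> {a..b}" "s \<le> t"
  have comp: "(\<lambda>n. x n u $ i) \<longlonglongrightarrow> y u $ i" "(\<lambda>n. C (x n u) $ i) \<longlonglongrightarrow> C (y u) $ i"
    if "u \<in> {a..b}" for u i
  proof -
    have x: "(\<lambda>n. x n u) \<longlonglongrightarrow> y u" using lim that by (rule tendsto_uniform_limitI)
    then show "(\<lambda>n. x n u $ i) \<longlonglongrightarrow> y u $ i" by (rule tendsto_vec_nth)
    have "(\<lambda>n. C (x n u)) \<longlonglongrightarrow> C (y u)"
      using C x by (intro bounded_linear.tendsto[of C]) (auto simp: linear_conv_bounded_linear)
    then show "(\<lambda>n. C (x n u) $ i) \<longlonglongrightarrow> C (y u) $ i" by (rule tendsto_vec_nth)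
  qed
  show "y t $ i - y s $ i =
      (\<Sum>j\<in>UNIV. A $ i $ j * ((C (y t) $ j - C (y s) $ j) - (C (y t) $ i - C (y s) $ i)))" for i
  proof (rule LIMSEQ_unique)
    show "(\<lambda>n. x n t $ i - x n s $ i) \<longlonglongrightarrow> y t $ i - y s $ i"
      using st by (intro tendsto_intros comp)
    have "(\<lambda>n. (\<Sum>j\<in>UNIV. A $ i $ j * ((C (x n t) $ j - C (x n s) $ j) - (C (x n t) $ i - C (x n s) $ i))))
      \<longlonglongrightarrow> (\<Sum>j\<in>UNIV. A $ i $ j * ((C (y t) $ j - C (y s) $ j) - (C (y t) $ i - C (y s) $ i)))"
      using st by (intro tendsto_intros comp)
    then show "(\<lambda>n. x n t $ i - x n s $ i)
      \<longlonglongrightarrow> (\<Sum>j\<in>UNIV. A $ i $ j * ((C (y t) $ j - C (y s) $ j) - (C (y t) $ i - C (y s) $ i)))"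
      using averaged_solution_increment[OF avg st] by simp
  qed
  fix i j \<alpha> \<gamma>
  assume \<alpha>: "\<forall>u\<in>{s..t}. \<alpha> < y u $ i" and \<gamma>: "\<forall>u\<in>{s..t}. y u $ j < \<gamma>"
  have sub: "{s..t} \<subseteq> {a..b}" using st by auto
  have ne: "{s..t} \<noteq> {}" using st by auto
  have cont: "continuous_on {s..t} (\<lambda>u. y u $ k)" for k
    by (intro continuous_intros continuous_on_subset[OF y sub])
  obtain u0 where u0: "u0 \<in> {s..t}" "\<forall>u\<in>{s..t}. y u0 $ i \<le> y u $ i"
    using continuous_attains_inf[OF compact_Icc ne cont] by blast
  obtain u1 where u1: "u1 \<in> {s..t}" "\<forall>u\<in>{s..t}. y u $ j \<le> y u1 $ j"
    using continuous_attains_sup[OF compact_Icc ne cont] by blast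
  have pos: "min (y u0 $ i - \<alpha>) (\<gamma> - y u1 $ j) > 0" using u0 u1 \<alpha> \<gamma> by auto
  have ev: "\<forall>\<^sub>F n in sequentially. \<forall>u\<in>{a..b}. dist (x n u) (y u) < min (y u0 $ i - \<alpha>) (\<gamma> - y u1 $ j)"
    using lim pos by (rule uniform_limitD)
  have "\<forall>\<^sub>F n in sequentially. (t - s) * (f \<alpha> - f \<gamma>) \<le>
      (C (x n t) $ i - C (x n s) $ i) - (C (x n t) $ j - C (x n s) $ j)"
    using ev
  proof eventually_elim
    case (elim n)
    have close: "\<bar>x n u $ k - y u $ k\<bar> < min (y u0 $ i - \<alpha>) (\<gamma> - y u1 $ j)" if "u \<in> {s..t}" for u k
    proof -
      have "dist (x n u) (y u) < min (y u0 $ i - \<alpha>) (\<gamma> - y u1 $ j)" using elim that sub by blast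
      then show ?thesis
        using component_le_norm_cart[of "x n u - y u" k] by (simp add: dist_norm)
    qed
    have "(t - s) * (f \<alpha> - f \<gamma>) \<le> (C (x n t) - C (x n s)) $ i - (C (x n t) - C (x n s)) $ j"
    proof (rule averaged_solution_order[OF avg st])
      fix u assume u: "u \<in> {s..t}"
      then have "y u0 $ i \<le> y u $ i" "y u $ j \<le> y u1 $ j" using u0(2) u1(2) by auto
      then show "\<alpha> < x n u $ i" "x n u $ j < \<gamma>"
        using close[OF u, of i] close[OF u, of j] by linarith+
    qed
    then show ?case by simp
  qed
  then show "(t - s) * (f \<alpha> - f \<gamma>) \<le> (C (y t) $ i - C (y s) $ i) - (C (y t) $ j - C (y s) $ j)"
    using st by (intro tendsto_lowerbound[OF _ _ sequentially_bot])
      (auto intro!: tendsto_intros comp)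
qed


text \<open>
  The shifts by \<open>n\<close> are bounded and equi-Lipschitz, so a subsequence converges uniformly. At every
  fixed time the extremes of the shifts tend to the limits at infinity.
\<close>
lemma limit_solution_constant_extremes:
  assumes avg: "\<And>a b. 0 \<le> a \<Longrightarrow> averaged_solution f {a..b} x (\<lambda>t. C (x t))"
    and f: "mono f" and C: "linear C"
    and B: "\<And>t i. 0 \<le> t \<Longrightarrow> \<bar>x t $ i\<bar> < B"
    and max: "((\<lambda>t. node_max (x t)) \<longlongrightarrow> M) at_top"
    and min: "((\<lambda>t. node_max (- x t)) \<longlongrightarrow> - m) at_top"
  shows "\<exists>y. averaged_solution f {0..T} y (\<lambda>t. C (y t)) \<and>
    (\<forall>t\<in>{0..T}. node_max (y t) = M \<and> node_max (- y t) = - m)"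
proof -
  define X where "X n t = x (real n + t)" for n t
  define \<Lambda> where "\<Lambda> = (\<Sum>i\<in>UNIV. \<Sum>j\<in>UNIV. A $ i $ j) * (f B - f (- B))"
  have "0 < B" using B[of 0 r] by linarith
  then have "f (- B) \<le> f B" by (intro monoD[OF f]) simp
  then have "0 \<le> \<Lambda>" unfolding \<Lambda>_def using nonneg by (intro mult_nonneg_nonneg sum_nonneg) auto
  have avgX: "averaged_solution f {0..T} (X n) (\<lambda>t. C (X n t))" for n
    unfolding X_def by (rule averaged_solution_shift[of _ "real n" 0 T x "\<lambda>t. C (x t)"]) (rule avg, simp)
  have BX: "\<bar>X n t $ i\<bar> < B" if "0 \<le> t" for n t i
    unfolding X_def using that by (intro B) simp
  have ordered: "norm (X n t - X n s) \<le> \<Lambda> * (t - s)" if "s \<in> {0..T}" "t \<in> {0..T}" "s \<le> t" for n s t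
    unfolding \<Lambda>_def using that by (intro averaged_solution_lipschitz[OF avgX] BX) auto
  have lip: "norm (X n s - X n t) \<le> \<Lambda> * norm (s - t)" if "s \<in> {0..T}" "t \<in> {0..T}" for n s t
    using ordered[of s t n] ordered[of t s n] that by (cases "s \<le> t") (auto simp: norm_minus_commute)
  obtain y k where y: "continuous_on {0..T} y" "strict_mono (k :: nat \<Rightarrow> nat)"
    "\<And>e. 0 < e \<Longrightarrow> \<exists>N. \<forall>n t. n \<ge> N \<and> t \<in> {0..T} \<longrightarrow> norm (X (k n) t - y t) < e"
  proof (rule Arzela_Ascoli[of "{0..T}" X "real CARD('n) * B"])
    show "norm (X n t) \<le> real CARD('n) * B" if "t \<in> {0..T}" for n t
    proof -
      have "norm (X n t) \<le> (\<Sum>i\<in>UNIV. \<bar>X n t $ i\<bar>)" by (rule norm_le_l1_cart)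
      also have "\<dots> \<le> (\<Sum>i\<in>(UNIV :: 'n set). B)"
        using that by (intro sum_mono less_imp_le[OF BX]) auto
      finally show ?thesis by simp
    qed
    fix s e :: real assume s: "s \<in> {0..T}" and "0 < e"
    have "norm (X n s - X n t) < e" if "t \<in> {0..T}" "norm (s - t) < e / (\<Lambda> + 1)" for n t
    proof -
      have "norm (X n s - X n t) \<le> \<Lambda> * norm (s - t)" by (rule lip[OF s that(1)])
      also have "\<dots> \<le> (\<Lambda> + 1) * norm (s - t)" by (simp add: mult_right_mono)
      also have "\<dots> < e" using that(2) \<open>0 \<le> \<Lambda>\<close> by (simp add: field_simps)
      finally show ?thesis .
    qed
    then show "\<exists>d>0. \<forall>n t. t \<in> {0..T} \<and> norm (s - t) < d \<longrightarrow> norm (X n s - X n t) < e"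
      using \<open>0 < e\<close> \<open>0 \<le> \<Lambda>\<close> by (intro exI[of _ "e / (\<Lambda> + 1)"]) auto
  qed auto
  have lim: "uniform_limit {0..T} (\<lambda>n. X (k n)) y sequentially"
    unfolding uniform_limit_sequentially_iff dist_norm using y(3) by blast
  have "averaged_solution f {0..T} y (\<lambda>t. C (y t))"
    by (rule averaged_solution_uniform_limit[OF avgX C y(1) lim])
  moreover have "node_max (y t) = M \<and> node_max (- y t) = - m" if t: "t \<in> {0..T}" for t
  proof -
    have Xy: "(\<lambda>n. X (k n) t) \<longlonglongrightarrow> y t" using lim t by (rule tendsto_uniform_limitI)
    have "filterlim (\<lambda>n. real (k n)) at_top sequentially"
      by (rule filterlim_compose[OF filterlim_real_sequentially filterlim_subseq[OF y(2)]])
    from filterlim_tendsto_add_at_top[OF tendsto_const[of t] this]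
    have "filterlim (\<lambda>n. real (k n) + t) at_top sequentially" by (simp add: add.commute)
    then have lims: "(\<lambda>n. node_max (X (k n) t)) \<longlonglongrightarrow> M" "(\<lambda>n. node_max (- X (k n) t)) \<longlonglongrightarrow> - m"
      unfolding X_def by (rule filterlim_compose[OF max], rule filterlim_compose[OF min])
    have cont: "(\<lambda>n. node_max (v n)) \<longlonglongrightarrow> node_max w" if "v \<longlonglongrightarrow> w" for v :: "nat \<Rightarrow> real ^ 'n" and w
      using continuous_node_max[of UNIV] that by (rule continuous_on_tendsto_compose) auto
    have "node_max (y t) = M" by (rule LIMSEQ_unique[OF cont[OF Xy] lims(1)])
    moreover have "node_max (- y t) = - m"
      by (rule LIMSEQ_unique[OF cont[OF tendsto_minus[OF Xy]] lims(2)])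
    ultimately show ?thesis ..
  qed
  ultimately show ?thesis by blast
qed

end

section \<open>Convergence\<close>

lemma nonincreasing_bounded_tendsto_at_top:
  fixes V :: "real \<Rightarrow> real"
  assumes mono: "\<And>s t. 0 \<le> s \<Longrightarrow> s \<le> t \<Longrightarrow> V t \<le> V s" and bdd: "\<And>t. 0 \<le> t \<Longrightarrow> B \<le> V t"
  obtains M where "(V \<longlongrightarrow> M) at_top" "\<And>t. 0 \<le> t \<Longrightarrow> M \<le> V t"
proof -
  define M where "M = Inf (V ` {0..})"
  have b: "bdd_below (V ` {0..})" using bdd by (intro bdd_belowI[of _ B]) auto
  have le: "M \<le> V t" if "0 \<le> t" for t
    unfolding M_def using that by (intro cInf_lower[OF _ b]) auto
  have "(V \<longlongrightarrow> M) at_top"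
  proof (rule order_tendstoI)
    fix c assume "c < M"
    then have "\<forall>t\<ge>0. c < V t" using le by (meson less_le_trans)
    then show "\<forall>\<^sub>F t in at_top. c < V t" unfolding eventually_at_top_linorder by blast
  next
    fix c assume "M < c"
    then obtain s where s: "0 \<le> s" "V s < c"
      unfolding M_def using cInf_lessD[of "V ` {0..}" c] by auto
    then have "\<forall>t\<ge>s. V t < c" using mono by (meson le_less_trans)
    then show "\<forall>\<^sub>F t in at_top. V t < c" unfolding eventually_at_top_linorder by blast
  qed
  with le that show thesis by blast
qed

context rooted_weights
begin

text \<open>
  The window length \<open>T\<close> is chosen so that the guaranteed growth \<open>T * (f \<alpha> - f \<gamma>)\<close> exceeds the a
  priori bound \<open>4 * Q\<close> on the difference of two increments of components of \<open>C y\<close>.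
\<close>
lemma constant_between_limit_extremes:
  assumes avg: "\<And>a b. 0 \<le> a \<Longrightarrow> averaged_solution f {a..b} x (\<lambda>t. C (x t))"
    and f: "mono f" and C: "linear C"
    and B: "\<And>t i. 0 \<le> t \<Longrightarrow> \<bar>x t $ i\<bar> < B"
    and max: "((\<lambda>t. node_max (x t)) \<longlongrightarrow> M) at_top"
    and min: "((\<lambda>t. node_max (- x t)) \<longlongrightarrow> - m) at_top"
    and le: "m < \<gamma>" "\<gamma> \<le> \<alpha>" "\<alpha> < M"
  shows "f \<alpha> = f \<gamma>"
proof (rule ccontr)
  assume "f \<alpha> \<noteq> f \<gamma>"
  then have gap: "f \<gamma> < f \<alpha>" using monoD[OF f le(2)] by simp
  obtain K where K: "0 < K" "\<And>v. norm (C v) \<le> norm v * K"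
    using bounded_linear.pos_bounded[of C] C by (auto simp: linear_conv_bounded_linear)
  define Q where "Q = real CARD('n) * max \<bar>m\<bar> \<bar>M\<bar> * K"
  have "0 \<le> Q" using K(1) by (simp add: Q_def)
  define T where "T = (4 * Q + 1) / (f \<alpha> - f \<gamma>)"
  have T: "0 < T" "T * (f \<alpha> - f \<gamma>) = 4 * Q + 1" using gap \<open>0 \<le> Q\<close> by (auto simp: T_def)
  obtain y where y: "averaged_solution f {0..2 * T} y (\<lambda>t. C (y t))"
    "\<forall>t\<in>{0..2 * T}. node_max (y t) = M \<and> node_max (- y t) = - m"
    using limit_solution_constant_extremes[OF avg f C B max min] by blast
  have b: "y t $ k \<le> M" "m \<le> y t $ k" if "t \<in> {0..2 * T}" for t k
    using y(2) that le_node_max[of "y t" k] le_node_max[of "- y t" k] by auto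
  have CQ: "\<bar>C (y t) $ k\<bar> \<le> Q" if t: "t \<in> {0..2 * T}" for t k
  proof -
    have "\<bar>y t $ i\<bar> \<le> max \<bar>m\<bar> \<bar>M\<bar>" for i using b[OF t, of i] by linarith
    then have "(\<Sum>i\<in>UNIV. \<bar>y t $ i\<bar>) \<le> (\<Sum>i\<in>(UNIV :: 'n set). max \<bar>m\<bar> \<bar>M\<bar>)" by (intro sum_mono)
    then have "norm (y t) \<le> real CARD('n) * max \<bar>m\<bar> \<bar>M\<bar>" using norm_le_l1_cart[of "y t"] by simp
    then have "norm (y t) * K \<le> Q" unfolding Q_def using K(1) by (intro mult_right_mono) auto
    then show ?thesis using K(2)[of "y t"] component_le_norm_cart[of "C (y t)" k] by linarith
  qed
  have att: "\<forall>t\<in>{0..2 * T}. \<exists>i. y t $ i = M" using y(2) node_max_attained by metis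
  have att': "\<forall>t\<in>{0..2 * T}. \<exists>i. y t $ i = m"
  proof
    fix t assume "t \<in> {0..2 * T}"
    then obtain i where "(- y t) $ i = - m" using y(2) node_max_attained by metis
    then show "\<exists>i. y t $ i = m" by auto
  qed
  have "m < M" using le by simp
  then obtain p i j where p: "0 \<le> p" "p + T \<le> 2 * T" "\<forall>t\<in>{p..p + T}. y t $ i = M \<and> y t $ j = m"
    using nodes_stay_at_extremes[OF y(1) f T(1)] b att att' by blast
  have ends: "p \<in> {0..2 * T}" "p + T \<in> {0..2 * T}" "p \<le> p + T" using p T by auto
  have "(p + T - p) * (f \<alpha> - f \<gamma>) \<le> (C (y (p + T)) - C (y p)) $ i - (C (y (p + T)) - C (y p)) $ j"
    using p(3) le by (intro averaged_solution_order[OF y(1) ends]) auto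
  also have "\<dots> \<le> 4 * Q"
    using CQ[OF ends(1), of i] CQ[OF ends(1), of j] CQ[OF ends(2), of i] CQ[OF ends(2), of j]
    by simp
  finally show False using T(2) by simp
qed

lemma complete_solution_converges:
  assumes sol: "complete_solution (consensus_rhs (laplacian A) f) x" and f: "mono f"
  shows "converges_asymptotically x (consensus_set f)"
proof -
  obtain C' where C': "linear C'" "\<And>w i. C' (laplacian A *v w) $ i = w $ i - w $ r"
    using laplacian_left_inverse by blast
  define C where "C v = - C' v" for v
  have C: "linear C" "\<And>w i. C (laplacian A *v w) $ i = w $ r - w $ i"
    unfolding C_def using C' by (auto intro: linear_compose_neg)
  have avg: "averaged_solution f {a..b} x (\<lambda>t. C (x t))" if "0 \<le> a" for a b
    by (rule inclusion_solution_averaged[OF sol f C that])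
  have up: "node_max (x t) \<le> node_max (x s)" if "0 \<le> s" "s \<le> t" for s t
    by (rule node_max_nonincreasing[OF avg]) (use that in auto)
  have dn: "node_max (- x t) \<le> node_max (- x s)" if "0 \<le> s" "s \<le> t" for s t
    by (rule node_max_nonincreasing[OF averaged_solution_reflect[OF avg]]) (use that in auto)
  have neg: "- node_max (- v) \<le> v $ i" for v :: "real ^ 'n" and i
    using le_node_max[of "- v" i] by simp
  have sum: "- node_max (- v) \<le> node_max v" for v :: "real ^ 'n"
    using neg[of v r] le_node_max[of v r] by linarith
  have "- node_max (- x 0) \<le> node_max (x t)" if "0 \<le> t" for t
    using dn[of 0 t] sum[of "x t"] that by linarith
  with up obtain M where M: "((\<lambda>t. node_max (x t)) \<longlongrightarrow> M) at_top" "\<And>t. 0 \<le> t \<Longrightarrow> M \<le> node_max (x t)"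
    using nonincreasing_bounded_tendsto_at_top[of "\<lambda>t. node_max (x t)"] by metis
  have "- node_max (x 0) \<le> node_max (- x t)" if "0 \<le> t" for t
    using up[of 0 t] sum[of "x t"] that by linarith
  with dn obtain m' where m': "((\<lambda>t. node_max (- x t)) \<longlongrightarrow> m') at_top"
      "\<And>t. 0 \<le> t \<Longrightarrow> m' \<le> node_max (- x t)"
    using nonincreasing_bounded_tendsto_at_top[of "\<lambda>t. node_max (- x t)"] by metis
  define m where "m = - m'"
  have min: "((\<lambda>t. node_max (- x t)) \<longlongrightarrow> - m) at_top" using m'(1) by (simp add: m_def)
  have "m \<le> M"
  proof -
    have "((\<lambda>t. node_max (x t) + node_max (- x t)) \<longlongrightarrow> M + m') at_top"
      by (intro tendsto_add M m')
    then have "0 \<le> M + m'"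
    proof (rule tendsto_lowerbound)
      show "\<forall>\<^sub>F t in at_top. 0 \<le> node_max (x t) + node_max (- x t)"
        using sum by (intro always_eventually allI) (smt (verit))
    qed simp
    then show ?thesis by (simp add: m_def)
  qed
  define B where "B = max \<bar>node_max (x 0)\<bar> \<bar>node_max (- x 0)\<bar> + 1"
  have B: "\<bar>x t $ i\<bar> < B" if "0 \<le> t" for t i
    using up[of 0 t] dn[of 0 t] that le_node_max[of "x t" i] neg[of "x t" i] unfolding B_def by linarith
  have const: "f \<alpha> = f \<gamma>" if "m < \<gamma>" "\<gamma> \<le> \<alpha>" "\<alpha> < M" for \<alpha> \<gamma>
    by (rule constant_between_limit_extremes[OF avg f C(1) B M(1) min that])
  have consensus: "v \<in> consensus_set f" if v: "\<And>i. m \<le> v $ i" "\<And>i. v $ i \<le> M" for v :: "real ^ 'n"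
  proof (cases "m < M")
    case True
    have "f u = f ((m + M) / 2)" if "m < u" "u < M" for u
      using const[of u "(m + M) / 2"] const[of "(m + M) / 2" u] that True
      by (cases "u \<le> (m + M) / 2") auto
    then have "f ((m + M) / 2) \<in> filippov_map f (v $ i)" for i
      using True v by (intro constant_in_filippov_map[of m M])
    then show ?thesis by (auto simp: consensus_set_def)
  next
    case False
    then have "v $ i = m" for i using v[of i] \<open>m \<le> M\<close> by linarith
    then show ?thesis using self_in_filippov_map[OF f, of m] by (auto simp: consensus_set_def)
  qed
  have bound: "infdist (x t) (consensus_set f) \<le>
      real CARD('n) * ((node_max (x t) - M) + (node_max (- x t) - m'))" if "0 \<le> t" for t
  proof -
    define v :: "real ^ 'n" where "v = (\<chi> i. max m (min M (x t $ i)))"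
    have "v \<in> consensus_set f" using \<open>m \<le> M\<close> by (intro consensus) (auto simp: v_def)
    then have "infdist (x t) (consensus_set f) \<le> norm (x t - v)"
      using infdist_le by (fastforce simp: dist_norm)
    also have "\<dots> \<le> (\<Sum>i\<in>UNIV. \<bar>(x t - v) $ i\<bar>)" by (rule norm_le_l1_cart)
    also have "\<dots> \<le> (\<Sum>i\<in>(UNIV :: 'n set). (node_max (x t) - M) + (node_max (- x t) - m'))"
    proof (rule sum_mono)
      fix i
      show "\<bar>(x t - v) $ i\<bar> \<le> (node_max (x t) - M) + (node_max (- x t) - m')"
        using le_node_max[of "x t" i] neg[of "x t" i] M(2)[OF that] m'(2)[OF that] \<open>m \<le> M\<close>
        by (simp add: v_def m_def)
    qed
    finally show ?thesis by simp
  qed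
  have "((\<lambda>t. infdist (x t) (consensus_set f)) \<longlongrightarrow> 0) at_top"
  proof (rule tendsto_sandwich)
    show "\<forall>\<^sub>F t in at_top. 0 \<le> infdist (x t) (consensus_set f)" by (simp add: infdist_nonneg)
    show "\<forall>\<^sub>F t in at_top. infdist (x t) (consensus_set f) \<le>
        real CARD('n) * ((node_max (x t) - M) + (node_max (- x t) - m'))"
      using eventually_ge_at_top[of 0] by eventually_elim (rule bound)
    have "((\<lambda>t. real CARD('n) * ((node_max (x t) - M) + (node_max (- x t) - m'))) \<longlongrightarrow>
        real CARD('n) * ((M - M) + (m' - m'))) at_top"
      by (intro tendsto_intros M m')
    then show "((\<lambda>t. real CARD('n) * ((node_max (x t) - M) + (node_max (- x t) - m'))) \<longlongrightarrow> 0) at_top"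
      by simp
  qed (rule tendsto_const)
  moreover have "((\<chi> i. m) :: real ^ 'n) \<in> consensus_set f" using \<open>m \<le> M\<close> by (intro consensus) auto
  ultimately show ?thesis by (auto simp: converges_asymptotically_def)
qed

end

theorem theorem3p4:
  fixes G :: "'n::finite pair_pre_digraph"
    and A :: "real ^ 'n ^ 'n"
    and f :: "real \<Rightarrow> real"
    and f_top f_bot :: ereal
  assumes graph: "weighted_digraph G A"
    and tree: "\<exists>T. directed_spanning_tree T G"
    and f_mono: "mono f"
    and f_at_top: "((\<lambda>s. ereal (f s)) \<longlongrightarrow> f_top) at_top" "f_top > 0"
    and f_at_bot: "((\<lambda>s. ereal (f s)) \<longlongrightarrow> f_bot) at_bot" "f_bot < 0"
    and complete: "\<And>x0. \<exists>x. complete_solution (consensus_rhs (laplacian A) f) x \<and> x 0 = x0"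
  shows "\<forall>x. complete_solution (consensus_rhs (laplacian A) f) x \<longrightarrow>
           converges_asymptotically x (consensus_set f)"
proof -
  obtain r where "rooted_weights A r"
    using tree directed_spanning_tree_rooted_weights[OF graph] by blast
  then show ?thesis using rooted_weights.complete_solution_converges f_mono by blast
qed

end
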